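(* Let $P$ be a locally compact Hausdorff space of class $\mathcal K_{\mathrm{IV}}$, let $\alpha P=P\cup\{p_\infty\}$ be its one-point compactification, and let $$K=\alpha P\times[0,\omega_0]\setminus\{(p_\infty,\omega_0)\},$$ where $[0,\omega_0]$ is the space of all ordinals $\le\omega_0$ (the first infinite ordinal) with the order topology. Then there are no frames, even non-standard ones, in $C_0(K)$.
   Context: Class $\mathcal K_{\mathrm{IV}}$: a locally compact Hausdorff space $P$ such that for every $\sigma$-compact subset $S\subset P$ (countable union of compact sets) the complement $P\setminus S$ has nonempty interior in $P$ and the point at infinity is an interior point of $\alpha P\setminus S$; equivalently, $P$ is non-compact and every $\sigma$-compact subset of $P$ has compact closure in $P$. $C_0(K)$ is the $C^*$-algebra of complex continuous functions on $K$ vanishing at infinity; it is a Hilbert module over itself, and over its unitalization, with inner product $\langle x,y\rangle=\overline{x}\,y$. $\dot{\mathcal A}$ denotes the unitalization of a $C^*$-algebra $\mathcal A$ (equal to $\mathcal A$ if $\mathcal A$ is unital). Frames: let $\mathcal N$ be a Hilbert $C^*$-module over a unital $C^*$-algebra $\mathcal A$. A family $\{x_j\}_{j\in J}$ (any index set) in $\mathcal N$ is a standard frame if there are constants $c_1,c_2>0$ such that for every $x\in\mathcal N$ the series $\sum_j\langle x,x_j\rangle\langle x_j,x\rangle$ converges in norm in $\mathcal A$ and $c_1\langle x,x\rangle\le\sum_j\langle x,x_j\rangle\langle x_j,x\rangle\le c_2\langle x,x\rangle$. It is a non-standard frame if the same holds with norm convergence replaced by convergence, in the ultraweak ($\sigma$-weak)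 topology, of the net of all finite partial sums to an element of the universal enveloping von Neumann algebra $\mathcal A''$ (the inequalities being understood in $\mathcal A''$). "Frame" means at least non-standard, i.e. the series converges at least ultraweakly. For a Hilbert module over a non-unital $\mathcal A$, frames are understood by viewing it as a module over $\dot{\mathcal A}$. *)

theory Defs
  imports "HOL-Analysis.Analysis" "HOL-Algebra.Ring"
begin

section \<open>Involutive algebras and Hilbert modules as carrier-based structures\<close>

record 'a star_algebra = "'a ring" +
  scl :: "complex \<Rightarrow> 'a \<Rightarrow> 'a"
  adj :: "'a \<Rightarrow> 'a"
  nrm :: "'a \<Rightarrow> real"

text \<open>The order of a \<open>C\<^sup>*\<close>-algebra: \<open>a \<le> b\<close> iff \<open>b - a\<close> is of the form \<open>d\<^sup>* d\<close>.\<close>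

definition alg_le :: "'a star_algebra \<Rightarrow> 'a \<Rightarrow> 'a \<Rightarrow> bool" where
  "alg_le A a b \<longleftrightarrow> (\<exists>d\<in>carrier A. b \<ominus>\<^bsub>A\<^esub> a = adj A d \<otimes>\<^bsub>A\<^esub> d)"

record ('m, 'a) hilbert_module = "'m partial_object" +
  madd :: "'m \<Rightarrow> 'm \<Rightarrow> 'm"
  mact :: "'m \<Rightarrow> 'a \<Rightarrow> 'm"
  mip  :: "'m \<Rightarrow> 'm \<Rightarrow> 'a"


section \<open>Complex Hilbert spaces and their operators\<close>

text \<open>Inner products are linear in the second argument. Operators are functions on the carrier;
  values elsewhere are irrelevant.\<close>

record 'h hilbert_space = "'h partial_object" +
  hadd :: "'h \<Rightarrow> 'h \<Rightarrow> 'h"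
  hscl :: "complex \<Rightarrow> 'h \<Rightarrow> 'h"
  hip  :: "'h \<Rightarrow> 'h \<Rightarrow> complex"

definition hnorm :: "'h hilbert_space \<Rightarrow> 'h \<Rightarrow> real" where
  "hnorm H v = sqrt (Re (hip H v v))"

definition bounded_ops :: "'h hilbert_space \<Rightarrow> ('h \<Rightarrow> 'h) set" where
  "bounded_ops H = {T. T \<in> carrier H \<rightarrow> carrier H \<and>
     (\<forall>u\<in>carrier H. \<forall>v\<in>carrier H. T (hadd H u v) = hadd H (T u) (T v)) \<and>
     (\<forall>c. \<forall>u\<in>carrier H. T (hscl H c u) = hscl H c (T u)) \<and>
     (\<exists>C. \<forall>u\<in>carrier H. hnorm H (T u) \<le> C * hnorm H u)}"

definition commutant :: "'h hilbert_space \<Rightarrow> ('h \<Rightarrow> 'h) set \<Rightarrow> ('h \<Rightarrow> 'h) set" where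
  "commutant H S = {T \<in> bounded_ops H. \<forall>R\<in>S. \<forall>u\<in>carrier H. T (R u) = R (T u)}"

definition op_le :: "'h hilbert_space \<Rightarrow> ('h \<Rightarrow> 'h) \<Rightarrow> ('h \<Rightarrow> 'h) \<Rightarrow> bool" where
  "op_le H S T \<longleftrightarrow> (\<forall>u\<in>carrier H. hip H u (T u) - hip H u (S u) \<in> \<real>\<^sub>\<ge>\<^sub>0)"

definition square_summable :: "'h hilbert_space \<Rightarrow> (nat \<Rightarrow> 'h) set" where
  "square_summable H = {\<xi>. (\<forall>n. \<xi> n \<in> carrier H) \<and> summable (\<lambda>n. (hnorm H (\<xi> n))\<^sup>2)}"

text \<open>Convergence in the ultraweak topology, the topology generated by the functionals
  \<open>T \<mapsto> \<Sum>n. \<langle>\<xi>\<^sub>n, T \<eta>\<^sub>n\<rangle>\<close> with \<open>\<xi>\<close>, \<open>\<eta>\<close> square summable.\<close>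

definition ultraweak_tendsto ::
  "'h hilbert_space \<Rightarrow> ('i \<Rightarrow> 'h \<Rightarrow> 'h) \<Rightarrow> ('h \<Rightarrow> 'h) \<Rightarrow> 'i filter \<Rightarrow> bool" where
  "ultraweak_tendsto H Ts T F \<longleftrightarrow>
     (\<forall>\<xi>\<in>square_summable H. \<forall>\<eta>\<in>square_summable H.
        ((\<lambda>i. \<Sum>n. hip H (\<xi> n) (Ts i (\<eta> n))) \<longlongrightarrow> (\<Sum>n. hip H (\<xi> n) (T (\<eta> n)))) F)"

definition hilbert_sum :: "'i set \<Rightarrow> ('i \<Rightarrow> 'h hilbert_space) \<Rightarrow> ('i \<Rightarrow> 'h) hilbert_space" where
  "hilbert_sum I Hs =
     \<lparr>carrier = {u \<in> (\<Pi>\<^sub>E i\<in>I. carrier (Hs i)). (\<lambda>i. (hnorm (Hs i) (u i))\<^sup>2) summable_on I},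
      hadd = (\<lambda>u v. \<lambda>i\<in>I. hadd (Hs i) (u i) (v i)),
      hscl = (\<lambda>c u. \<lambda>i\<in>I. hscl (Hs i) c (u i)),
      hip = (\<lambda>u v. \<Sum>\<^sub>\<infinity>i\<in>I. hip (Hs i) (u i) (v i))\<rparr>"


section \<open>The universal enveloping von Neumann algebra\<close>

text \<open>States of a unital \<open>C\<^sup>*\<close>-algebra.\<close>

definition states :: "'a star_algebra \<Rightarrow> ('a \<Rightarrow> complex) set" where
  "states A = {\<phi> \<in> extensional (carrier A).
     (\<forall>a\<in>carrier A. \<forall>b\<in>carrier A. \<phi> (a \<oplus>\<^bsub>A\<^esub> b) = \<phi> a + \<phi> b) \<and>
     (\<forall>c. \<forall>a\<in>carrier A. \<phi> (scl A c a) = c * \<phi> a) \<and>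
     (\<forall>a\<in>carrier A. \<phi> (adj A a \<otimes>\<^bsub>A\<^esub> a) \<in> \<real>\<^sub>\<ge>\<^sub>0) \<and>
     \<phi> \<one>\<^bsub>A\<^esub> = 1}"

text \<open>The GNS space of a state \<open>\<phi>\<close> is the completion of \<open>A\<close> with respect to the semi-inner product
  \<open>\<langle>a, b\<rangle> = \<phi> (a\<^sup>* b)\<close>: Cauchy sequences in \<open>A\<close> modulo sequences of limit \<open>0\<close>. This performs the
  quotient by the null space of \<open>\<phi>\<close> and the completion in one step.\<close>

definition gns_dist2 :: "'a star_algebra \<Rightarrow> ('a \<Rightarrow> complex) \<Rightarrow> 'a \<Rightarrow> 'a \<Rightarrow> real" where
  "gns_dist2 A \<phi> a b = Re (\<phi> (adj A (a \<ominus>\<^bsub>A\<^esub> b) \<otimes>\<^bsub>A\<^esub> (a \<ominus>\<^bsub>A\<^esub> b)))"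

definition gns_Cauchy :: "'a star_algebra \<Rightarrow> ('a \<Rightarrow> complex) \<Rightarrow> (nat \<Rightarrow> 'a) set" where
  "gns_Cauchy A \<phi> = {s. (\<forall>n. s n \<in> carrier A) \<and>
     (\<forall>\<epsilon>>0. \<exists>N. \<forall>m\<ge>N. \<forall>n\<ge>N. gns_dist2 A \<phi> (s m) (s n) < \<epsilon>)}"

definition gns_rel :: "'a star_algebra \<Rightarrow> ('a \<Rightarrow> complex) \<Rightarrow> (nat \<Rightarrow> 'a) rel" where
  "gns_rel A \<phi> = {(s, t). s \<in> gns_Cauchy A \<phi> \<and> t \<in> gns_Cauchy A \<phi> \<and>
     (\<lambda>n. gns_dist2 A \<phi> (s n) (t n)) \<longlonglongrightarrow> 0}"

definition repr :: "'b set \<Rightarrow> 'b" where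
  "repr F = (SOME s. s \<in> F)"

definition gns_space :: "'a star_algebra \<Rightarrow> ('a \<Rightarrow> complex) \<Rightarrow> (nat \<Rightarrow> 'a) set hilbert_space" where
  "gns_space A \<phi> =
     \<lparr>carrier = gns_Cauchy A \<phi> // gns_rel A \<phi>,
      hadd = (\<lambda>F G. gns_rel A \<phi> `` {\<lambda>n. repr F n \<oplus>\<^bsub>A\<^esub> repr G n}),
      hscl = (\<lambda>c F. gns_rel A \<phi> `` {\<lambda>n. scl A c (repr F n)}),
      hip = (\<lambda>F G. lim (\<lambda>n. \<phi> (adj A (repr F n) \<otimes>\<^bsub>A\<^esub> repr G n)))\<rparr>"

definition gns_rep ::
  "'a star_algebra \<Rightarrow> ('a \<Rightarrow> complex) \<Rightarrow> 'a \<Rightarrow> (nat \<Rightarrow> 'a) set \<Rightarrow> (nat \<Rightarrow> 'a) set" where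
  "gns_rep A \<phi> a F = gns_rel A \<phi> `` {\<lambda>n. a \<otimes>\<^bsub>A\<^esub> repr F n}"

text \<open>The universal representation is the direct sum of the GNS representations of all states.\<close>

type_synonym 'a universal_vector = "('a \<Rightarrow> complex) \<Rightarrow> (nat \<Rightarrow> 'a) set"

definition universal_space :: "'a star_algebra \<Rightarrow> 'a universal_vector hilbert_space" where
  "universal_space A = hilbert_sum (states A) (gns_space A)"

definition universal_rep ::
  "'a star_algebra \<Rightarrow> 'a \<Rightarrow> 'a universal_vector \<Rightarrow> 'a universal_vector" where
  "universal_rep A a u = (\<lambda>\<phi>\<in>states A. gns_rep A \<phi> a (u \<phi>))"

definition enveloping_vN ::
  "'a star_algebra \<Rightarrow> ('a universal_vector \<Rightarrow> 'a universal_vector) set" where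
  "enveloping_vN A =
     commutant (universal_space A) (commutant (universal_space A) (universal_rep A ` carrier A))"


section \<open>Frames\<close>

definition frame_partial_sum ::
  "'a star_algebra \<Rightarrow> ('m, 'a) hilbert_module \<Rightarrow> ('j \<Rightarrow> 'm) \<Rightarrow> 'm \<Rightarrow> 'j set \<Rightarrow> 'a" where
  "frame_partial_sum A N x y F = (\<Oplus>\<^bsub>A\<^esub>j\<in>F. mip N y (x j) \<otimes>\<^bsub>A\<^esub> mip N (x j) y)"

definition standard_frame ::
  "'a star_algebra \<Rightarrow> ('m, 'a) hilbert_module \<Rightarrow> 'j set \<Rightarrow> ('j \<Rightarrow> 'm) \<Rightarrow> bool" where
  "standard_frame A N J x \<longleftrightarrow> x \<in> J \<rightarrow> carrier N \<and>
     (\<exists>c1>0. \<exists>c2>0. \<forall>y\<in>carrier N. \<exists>s\<in>carrier A.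
        ((\<lambda>F. nrm A (frame_partial_sum A N x y F \<ominus>\<^bsub>A\<^esub> s)) \<longlongrightarrow> 0) (finite_subsets_at_top J) \<and>
        alg_le A (scl A (complex_of_real c1) (mip N y y)) s \<and>
        alg_le A s (scl A (complex_of_real c2) (mip N y y)))"

definition nonstandard_frame ::
  "'a star_algebra \<Rightarrow> ('m, 'a) hilbert_module \<Rightarrow> 'j set \<Rightarrow> ('j \<Rightarrow> 'm) \<Rightarrow> bool" where
  "nonstandard_frame A N J x \<longleftrightarrow> x \<in> J \<rightarrow> carrier N \<and>
     (\<exists>c1>0. \<exists>c2>0. \<forall>y\<in>carrier N. \<exists>T\<in>enveloping_vN A.
        ultraweak_tendsto (universal_space A)
          (\<lambda>F. universal_rep A (frame_partial_sum A N x y F)) T (finite_subsets_at_top J) \<and>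
        op_le (universal_space A)
          (universal_rep A (scl A (complex_of_real c1) (mip N y y))) T \<and>
        op_le (universal_space A)
          T (universal_rep A (scl A (complex_of_real c2) (mip N y y))))"

definition frame ::
  "'a star_algebra \<Rightarrow> ('m, 'a) hilbert_module \<Rightarrow> 'j set \<Rightarrow> ('j \<Rightarrow> 'm) \<Rightarrow> bool" where
  "frame A N J x \<longleftrightarrow> standard_frame A N J x \<or> nonstandard_frame A N J x"


section \<open>The algebra of functions vanishing at infinity\<close>

text \<open>Functions on a space \<open>X\<close> are represented by functions on the underlying type that are
  \<open>0\<close> outside \<open>topspace X\<close>.\<close>

definition C0 :: "'k topology \<Rightarrow> ('k \<Rightarrow> complex) set" where
  "C0 X = {f. continuous_map X euclidean f \<and>
     (\<forall>\<epsilon>>0. compactin X {t \<in> topspace X. \<epsilon> \<le> cmod (f t)}) \<and>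
     (\<forall>t. t \<notin> topspace X \<longrightarrow> f t = 0)}"

text \<open>The unitalization of \<open>C\<^sub>0(X)\<close>, realised as the subalgebra \<open>C\<^sub>0(X) + \<complex>1\<close> of the bounded
  continuous functions; for compact \<open>X\<close> it is \<open>C\<^sub>0(X) = C(X)\<close> itself.\<close>

definition C0_unitalization :: "'k topology \<Rightarrow> ('k \<Rightarrow> complex) star_algebra" where
  "C0_unitalization X =
     \<lparr>carrier = {\<lambda>t. f t + c * indicator (topspace X) t | f c. f \<in> C0 X},
      mult = (\<lambda>f g t. f t * g t),
      one = indicator (topspace X),
      zero = (\<lambda>t. 0),
      add = (\<lambda>f g t. f t + g t),
      scl = (\<lambda>c f t. c * f t),
      adj = (\<lambda>f t. cnj (f t)),
      nrm = (\<lambda>f. SUP t\<in>topspace X. cmod (f t))\<rparr>"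

definition C0_module :: "'k topology \<Rightarrow> ('k \<Rightarrow> complex, 'k \<Rightarrow> complex) hilbert_module" where
  "C0_module X =
     \<lparr>carrier = C0 X,
      madd = (\<lambda>f g t. f t + g t),
      mact = (\<lambda>f a t. f t * a t),
      mip = (\<lambda>f g t. cnj (f t) * g t)\<rparr>"


section \<open>The spaces\<close>

definition sigma_compactin :: "'p topology \<Rightarrow> 'p set \<Rightarrow> bool" where
  "sigma_compactin X S \<longleftrightarrow> (\<exists>C::nat \<Rightarrow> 'p set. (\<forall>n. compactin X (C n)) \<and> S = (\<Union>n. C n))"

text \<open>In \<^const>\<open>Alexandroff_compactification\<close> the point at infinity is \<^const>\<open>None\<close>.\<close>

definition class_K_IV :: "'p topology \<Rightarrow> bool" where
  "class_K_IV P \<longleftrightarrow> locally_compact_space P \<and> Hausdorff_space P \<and>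
     (\<forall>S. sigma_compactin P S \<longrightarrow>
        P interior_of (topspace P - S) \<noteq> {} \<and>
        None \<in> Alexandroff_compactification P interior_of
                 (topspace (Alexandroff_compactification P) - Some ` S))"

text \<open>The ordered set \<open>[0, \<omega>\<^sub>0]\<close> of ordinals is the type \<^typ>\<open>enat\<close>, whose topology is the order
  topology; \<open>\<omega>\<^sub>0\<close> is \<open>\<infinity>\<close>.\<close>

definition space_K :: "'p topology \<Rightarrow> ('p option \<times> enat) topology" where
  "space_K P = subtopology
     (prod_topology (Alexandroff_compactification P) (euclidean :: enat topology))
     (topspace (Alexandroff_compactification P) \<times> UNIV - {(None, \<infinity>)})"

end

theory Submission
  imports Defs
begin

text \<open>Tested on the vector state of a point evaluation, even a non-standard frame \<open>(x\<^sub>j)\<close> satisfies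
  \<open>c \<bar>y(t)\<bar>\<^sup>2 \<le> \<Sum>\<^sub>j \<bar>y(t)\<bar>\<^sup>2 \<bar>x\<^sub>j(t)\<bar>\<^sup>2 < \<infinity>\<close> at every point \<open>t\<close>. Hence at every \<open>t\<close> some, but only
  countably many, of the \<open>x\<^sub>j\<close> are nonzero. On the closed copy \<open>P \<times> {\<omega>\<^sub>0}\<close> of \<open>P\<close> in \<open>K\<close> the sets
  \<open>{x\<^sub>j \<noteq> 0}\<close> therefore form a point-countable cover of \<open>P\<close> by open \<open>\<sigma>\<close>-compact sets, and a space of
  class \<open>K\<^sub>I\<^sub>V\<close> has no such cover.\<close>

section \<open>Point-countable covers and the space \<open>K\<close>\<close>

text \<open>The corner \<open>(None, \<infinity>)\<close> is removed so that the slice over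
  \<open>\<infinity>\<close> becomes closed: its closure in the full product adds at most that
  point. A superlevel set of a function vanishing at infinity then meets the slice in a compact set,
  which makes the members of the cover sigma-compact. The analytic difficulty is that
  \<open>hip\<close> of a GNS space is a limit along chosen representatives, and the universal inner
  product is a sum over all states. To read off a value at one point, all other summands must be
  shown to vanish. This is not immediate, because the representative chosen for the zero class is an
  arbitrary null sequence; hence an estimate of Cauchy-Schwarz type is proved for every state and
  not just for evaluations.\<close>

lemma compactin_imp_sigma_compactin: "compactin X C \<Longrightarrow> sigma_compactin X C"
  unfolding sigma_compactin_def by (rule exI[of _ "\<lambda>_. C"]) auto

lemma sigma_compactin_UN:
  assumes "countable I" and "\<And>i. i \<in> I \<Longrightarrow> sigma_compactin X (S i)"
  shows "sigma_compactin X (\<Union>i\<in>I. S i)"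
proof (cases "I = {}")
  case True
  then show ?thesis by (simp add: compactin_imp_sigma_compactin)
next
  case False
  obtain C where C: "\<And>i n. i \<in> I \<Longrightarrow> compactin X (C i (n::nat))" "\<And>i. i \<in> I \<Longrightarrow> S i = (\<Union>n. C i n)"
    using assms(2) unfolding sigma_compactin_def by metis
  \<comment> \<open>\<open>from_nat_into\<close> may enumerate \<open>I\<close> with repetitions,
    but needs \<open>I\<close> nonempty, hence the case split; \<open>prod_decode\<close> merges the
    two indices into one.\<close>
  define D where "D k = C (from_nat_into I (fst (prod_decode k))) (snd (prod_decode k))" for k
  have "compactin X (D k)" for k
    using C(1) from_nat_into[OF False] by (simp add: D_def)
  moreover have "(\<Union>i\<in>I. S i) = (\<Union>k. D k)"
  proof
    show "(\<Union>i\<in>I. S i) \<subseteq> (\<Union>k. D k)"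
    proof
      fix x assume "x \<in> (\<Union>i\<in>I. S i)"
      then obtain i n where "i \<in> I" "x \<in> C i n" using C(2) by blast
      moreover obtain m where "from_nat_into I m = i"
        using from_nat_into_surj[OF assms(1) \<open>i \<in> I\<close>] by blast
      ultimately have "x \<in> D (prod_encode (m, n))" by (simp add: D_def)
      then show "x \<in> (\<Union>k. D k)" by blast
    qed
    show "(\<Union>k. D k) \<subseteq> (\<Union>i\<in>I. S i)"
      using C(2) from_nat_into[OF False] by (fastforce simp: D_def)
  qed
  ultimately show ?thesis unfolding sigma_compactin_def by blast
qed

lemma class_K_IV_sigma_compactin_neq:
  assumes "class_K_IV P" "sigma_compactin P S"
  shows "\<exists>p\<in>topspace P. p \<notin> S"
  using assms interior_of_subset[of P "topspace P - S"] unfolding class_K_IV_def by blast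

text \<open>Open neighbourhoods of \<open>None\<close> are complements of compact subsets of
  \<open>P\<close>, so \<open>None\<close> is interior to the complement of \<open>S\<close> only if
  \<open>S\<close> lies in a compact set.\<close>

lemma class_K_IV_sigma_compactin_subset_compactin:
  assumes "class_K_IV P" "sigma_compactin P S"
  obtains C where "compactin P C" "S \<subseteq> C"
proof -
  let ?A = "Alexandroff_compactification P"
  have "None \<in> ?A interior_of (topspace ?A - Some ` S)"
    using assms unfolding class_K_IV_def by blast
  then obtain U where U: "openin ?A U" "None \<in> U" "U \<subseteq> topspace ?A - Some ` S"
    by (auto simp: interior_of_def)
  then obtain C where C: "compactin P C" "U = topspace ?A - Some ` C"
    by (auto simp: openin_Alexandroff_compactification)
  have "S \<subseteq> topspace P"
    using assms(2) compactin_subset_topspace unfolding sigma_compactin_def by blast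
  then have "S \<subseteq> C" using U(3) C(2) by (auto simp: image_iff)
  with C(1) that show thesis by blast
qed

text \<open>Choose points \<open>p\<^sub>0, p\<^sub>1, \<dots>\<close>, each outside all members of the cover that contain an earlier
  point. They lie in a compact set, which finitely many members cover; but no member contains two of
  the points.\<close>

lemma class_K_IV_no_point_countable_cover:
  assumes P: "class_K_IV P"
    and open_V: "\<And>j. j \<in> J \<Longrightarrow> openin P (V j)"
    and sigma_V: "\<And>j. j \<in> J \<Longrightarrow> sigma_compactin P (V j)"
    and cover: "topspace P \<subseteq> (\<Union>j\<in>J. V j)"
    and ctbl: "\<And>p. p \<in> topspace P \<Longrightarrow> countable {j\<in>J. p \<in> V j}"
  shows False
proof -
  have "\<exists>p::nat \<Rightarrow> _. \<forall>n. p n \<in> topspace P \<and> (\<forall>m<n. \<forall>j\<in>J. p m \<in> V j \<longrightarrow> p n \<notin> V j)"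
  proof (rule dependent_wellorder_choice)
    fix n :: nat and p
    assume "\<And>m. m < n \<Longrightarrow> p m \<in> topspace P \<and> (\<forall>l<m. \<forall>j\<in>J. p l \<in> V j \<longrightarrow> p m \<notin> V j)"
    \<comment> \<open>Each of the finitely many earlier points lies in only countably many
      \<open>V j\<close>, so the union to be avoided is again sigma-compact and cannot exhaust
      \<open>P\<close>.\<close>
    then have "sigma_compactin P (\<Union>j\<in>(\<Union>m\<in>{..<n}. {j\<in>J. p m \<in> V j}). V j)"
      by (intro sigma_compactin_UN countable_UN) (auto simp: ctbl sigma_V)
    from class_K_IV_sigma_compactin_neq[OF P this]
    show "\<exists>r. r \<in> topspace P \<and> (\<forall>m<n. \<forall>j\<in>J. p m \<in> V j \<longrightarrow> r \<notin> V j)"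
      by blast
  qed auto
  then obtain p :: "nat \<Rightarrow> _" where p: "\<And>n. p n \<in> topspace P"
    and fresh: "\<And>m n j. m < n \<Longrightarrow> j \<in> J \<Longrightarrow> p m \<in> V j \<Longrightarrow> p n \<notin> V j"
    by blast
  \<comment> \<open>A countable set is sigma-compact, so the whole sequence is caught in one compact
    set.\<close>
  have "sigma_compactin P (\<Union>n. {p n})"
    by (intro sigma_compactin_UN compactin_imp_sigma_compactin) (auto simp: p)
  moreover have "(\<Union>n. {p n}) = range p" by blast
  ultimately have "sigma_compactin P (range p)" by simp
  then obtain C where C: "compactin P C" "range p \<subseteq> C"
    by (rule class_K_IV_sigma_compactin_subset_compactin[OF P])
  then have "C \<subseteq> \<Union> (V ` J)" using cover compactin_subset_topspace by blast
  moreover have "\<forall>U\<in>V ` J. openin P U" using open_V by blast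
  ultimately obtain \<F> where \<F>: "finite \<F>" "\<F> \<subseteq> V ` J" "C \<subseteq> \<Union> \<F>"
    using C(1) unfolding compactin_def by meson
  then obtain F where F: "finite F" "F \<subseteq> J" "C \<subseteq> \<Union> (V ` F)"
    using finite_subset_image[OF \<F>(1,2)] by metis
  have "\<exists>j\<in>F. p n \<in> V j" for n using C(2) F(3) by blast
  then obtain c where c: "\<And>n. c n \<in> F \<and> p n \<in> V (c n)" by metis
  have "inj c"
  proof (rule linorder_injI)
    show "c m \<noteq> c n" if "m < n" for m n
      using fresh[OF that] c F(2) by (metis subsetD)
  qed
  then show False
    using c F(1) by (metis finite_subset image_subsetI infinite_UNIV_nat finite_imageD)
qed

section \<open>The punctured product and its top slice\<close>

lemma topspace_space_K:
  "topspace (space_K P) = insert None (Some ` topspace P) \<times> UNIV - {(None, \<infinity>)}"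
  by (auto simp: space_K_def)

lemma continuous_map_space_K_top: "continuous_map P (space_K P) (\<lambda>p. (Some p, \<infinity>))"
  unfolding space_K_def
  by (rule continuous_map_into_subtopology)
     (auto simp: continuous_map_paired continuous_map_Some)

text \<open>Adding \<open>None\<close> to the image of \<open>C\<close> gives a closed set of the
  compactification, since its complement is the open image of \<open>topspace P - C\<close>. Its
  product with \<open>{\<infinity>}\<close> is closed, and restriction to the punctured space
  deletes exactly the extra corner.\<close>

lemma closed_map_space_K_top: "closed_map P (space_K P) (\<lambda>p. (Some p, \<infinity>))"
  unfolding closed_map_def
proof (intro allI impI)
  fix C assume C: "closedin P C"
  let ?A = "Alexandroff_compactification P"
  let ?D = "(insert None (Some ` C)) \<times> {\<infinity>::enat}"
  have "closedin ?A (topspace ?A - Some ` (topspace P - C))"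
    unfolding closedin_Alexandroff_compactification
    by (intro disjI2 exI[of _ "topspace P - C"] conjI refl openin_diff openin_topspace C)
  moreover have "topspace ?A - Some ` (topspace P - C) = insert None (Some ` C)"
    using closedin_subset[OF C] by auto
  ultimately have "closedin ?A (insert None (Some ` C))" by simp
  then have "closedin (prod_topology ?A euclidean) ?D"
    unfolding closedin_prod_Times_iff by simp
  moreover have "(\<lambda>p. (Some p, \<infinity>)) ` C = ?D \<inter> (topspace ?A \<times> UNIV - {(None, \<infinity>)})"
    using closedin_subset[OF C] by force
  ultimately show "closedin (space_K P) ((\<lambda>p. (Some p, \<infinity>)) ` C)"
    unfolding space_K_def closedin_subtopology by blast
qed

text \<open>A closed injection is proper, so compact sets pull back to compact sets.\<close>

lemma compactin_space_K_top:
  assumes "compactin (space_K P) C"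
  shows "compactin P {p \<in> topspace P. (Some p, \<infinity>) \<in> C}"
  using assms closed_map_space_K_top
  by (intro compactin_proper_map_preimage[of P "space_K P"] closed_injective_imp_proper_map)
     (auto simp: inj_on_def)

text \<open>Complete regularity of the compactification supplies \<open>f\<close> with value 0 at
  \<open>Some p\<close> and 1 at \<open>None\<close>. Then \<open>1 - f\<close> composed with
  \<open>fst\<close> is nonzero at the given point and vanishes on the whole fibre over
  \<open>None\<close>, which contains the missing corner.\<close>

lemma C0_space_K_nonzero:
  assumes P: "locally_compact_space P" "Hausdorff_space P" and p: "p \<in> topspace P"
  shows "\<exists>y\<in>C0 (space_K P). y (Some p, \<infinity>) \<noteq> 0"
proof -
  let ?A = "Alexandroff_compactification P" and ?X = "prod_topology (Alexandroff_compactification P) (euclidean :: enat topology)"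
  have "completely_regular_space ?A"
    using P by (simp add: compact_Hausdorff_or_regular_imp_normal_space
        normal_imp_completely_regular_space Hausdorff_space_Alexandroff_compactification)
  moreover have "{None} = topspace ?A - Some ` topspace P" by auto
  then have "closedin ?A {None}"
    unfolding closedin_Alexandroff_compactification by blast
  moreover have "Some p \<in> topspace ?A - {None}" using p by simp
  ultimately obtain f :: "_ \<Rightarrow> real" where f: "continuous_map ?A (top_of_set {0..1}) f" "f (Some p) = 0" "f ` {None} \<subseteq> {1}"
    unfolding completely_regular_space_def by blast
  have f1: "continuous_map ?A euclidean f"
    using f(1) by (simp add: continuous_map_in_subtopology)
  define h where "h t = complex_of_real (1 - f (fst t))" for t :: "_ \<times> enat"
  define y where "y t = (if t \<in> topspace (space_K P) then h t else 0)" for t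
  have h: "continuous_map ?X euclidean h"
    unfolding h_def
    by (intro continuous_map_compose[of _ euclidean "\<lambda>t. 1 - f (fst t)" euclidean complex_of_real, unfolded o_def]
        continuous_map_diff continuous_map_compose[of _ ?A fst _ f, unfolded o_def] f1 continuous_map_fst)
      (auto intro!: continuous_intros simp: continuous_map_iff_continuous2)
  have cy: "continuous_map (space_K P) euclidean y"
  proof (rule continuous_map_eq)
    show "continuous_map (space_K P) euclidean h"
      unfolding space_K_def by (rule continuous_map_from_subtopology[OF h])
  qed (simp add: y_def)
  moreover have "compactin (space_K P) {t \<in> topspace (space_K P). \<epsilon> \<le> cmod (y t)}" if "\<epsilon> > 0" for \<epsilon>
  proof -
    \<comment> \<open>As \<open>h\<close> vanishes over \<open>None\<close>, the superlevel set
      agrees with the one taken in the full compact product, where closed sets are compact.\<close>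
    have eq: "{t \<in> topspace (space_K P). \<epsilon> \<le> cmod (y t)} = {t \<in> topspace ?X. h t \<in> {z. \<epsilon> \<le> cmod z}}"
      using that f(3) by (auto simp: y_def topspace_space_K h_def)
    have "closed {z. \<epsilon> \<le> cmod z}" by (intro closed_Collect_le continuous_intros)
    then have "closedin ?X {t \<in> topspace ?X. h t \<in> {z. \<epsilon> \<le> cmod z}}"
      using h by (intro closedin_continuous_map_preimage) auto
    moreover have "compact_space ?X"
    proof -
      have "compact_space (euclidean :: enat topology)"
        using compact_UNIV[where 'a = enat] by (simp add: compact_space_def)
      then show ?thesis by (simp add: compact_space_prod_topology)
    qed
    ultimately have "compactin ?X {t \<in> topspace (space_K P). \<epsilon> \<le> cmod (y t)}"
      unfolding eq by (rule closedin_compact_space[rotated])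
    then show ?thesis
      by (subst (1) space_K_def) (auto simp: compactin_subtopology topspace_space_K)
  qed
  moreover have "y (Some p, \<infinity>) \<noteq> 0"
    using p f(2) by (simp add: y_def h_def topspace_space_K)
  ultimately show ?thesis
    by (intro bexI[of _ y]) (auto simp: C0_def y_def)
qed

section \<open>The unitalization of \<open>C\<^sub>0(X)\<close>\<close>

text \<open>By continuity the superlevel set is closed, so enclosing it in a compact set
  suffices.\<close>

lemma C0_intro:
  assumes cont: "continuous_map X euclidean g"
    and zero: "\<And>t. t \<notin> topspace X \<Longrightarrow> g t = 0"
    and dom: "\<And>\<epsilon>. \<epsilon> > 0 \<Longrightarrow>
      \<exists>C. compactin X C \<and> {t \<in> topspace X. \<epsilon> \<le> cmod (g t)} \<subseteq> C"
  shows "g \<in> C0 X"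
proof -
  have "compactin X {t \<in> topspace X. \<epsilon> \<le> cmod (g t)}" if \<epsilon>: "\<epsilon> > 0" for \<epsilon>
  proof -
    obtain C where C: "compactin X C" "{t \<in> topspace X. \<epsilon> \<le> cmod (g t)} \<subseteq> C"
      using dom[OF \<epsilon>] by blast
    have "closed {z. \<epsilon> \<le> cmod z}"
      by (intro closed_Collect_le continuous_intros)
    then have "closedin X {t \<in> topspace X. g t \<in> {z. \<epsilon> \<le> cmod z}}"
      using cont by (intro closedin_continuous_map_preimage) auto
    then have "closedin X {t \<in> topspace X. \<epsilon> \<le> cmod (g t)}" by simp
    then show ?thesis using closed_compactin C by blast
  qed
  then show ?thesis using cont zero by (simp add: C0_def)
qed

lemma
  assumes "f \<in> C0 X"
  shows C0_continuous: "continuous_map X euclidean f"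
    and C0_outside: "t \<notin> topspace X \<Longrightarrow> f t = 0"
    and C0_compactin: "\<epsilon> > 0 \<Longrightarrow> compactin X {t \<in> topspace X. \<epsilon> \<le> cmod (f t)}"
  using assms by (auto simp: C0_def)

lemma zero_in_C0: "(\<lambda>t. 0) \<in> C0 X"
  by (simp add: C0_def)

lemma C0_add:
  assumes f: "f \<in> C0 X" and g: "g \<in> C0 X"
  shows "(\<lambda>t. f t + g t) \<in> C0 X"
proof (rule C0_intro)
  show "continuous_map X euclidean (\<lambda>t. f t + g t)"
    by (intro continuous_map_add C0_continuous f g)
  show "f t + g t = 0" if "t \<notin> topspace X" for t
    using that by (simp add: C0_outside[OF f] C0_outside[OF g])
  fix \<epsilon> :: real assume "\<epsilon> > 0"
  then have "compactin X ({t \<in> topspace X. \<epsilon>/2 \<le> cmod (f t)} \<union> {t \<in> topspace X. \<epsilon>/2 \<le> cmod (g t)})"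
    by (intro compactin_Un C0_compactin f g) auto
  moreover have "\<epsilon>/2 \<le> cmod a \<or> \<epsilon>/2 \<le> cmod b" if "\<epsilon> \<le> cmod (a + b)" for a b
    using norm_triangle_ineq[of a b] that by linarith
  ultimately show "\<exists>C. compactin X C \<and> {t \<in> topspace X. \<epsilon> \<le> cmod (f t + g t)} \<subseteq> C"
    by blast
qed

lemma C0_bounded:
  assumes f: "f \<in> C0 X"
  obtains M where "M > 0" "\<And>t. cmod (f t) \<le> M"
proof -
  let ?C = "{t \<in> topspace X. 1 \<le> cmod (f t)}"
  have "compactin euclidean (f ` ?C)"
    by (rule image_compactin[OF C0_compactin[OF f] C0_continuous[OF f]]) simp
  then have "bounded (f ` ?C)" by (simp add: compact_imp_bounded)
  then obtain B where B: "\<And>t. t \<in> ?C \<Longrightarrow> cmod (f t) \<le> B"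
    by (auto simp: bounded_iff)
  have "cmod (f t) \<le> max B 1" for t
  proof (cases "t \<in> ?C")
    case True
    then show ?thesis using B[of t] by (simp add: le_max_iff_disj)
  next
    case False
    then have "cmod (f t) \<le> 1" using C0_outside[OF f, of t] by fastforce
    then show ?thesis by simp
  qed
  then show thesis by (intro that[of "max B 1"]) auto
qed

text \<open>By continuity at 0, \<open>h\<close> can exceed \<epsilon> only where its argument has
  modulus at least some \<delta>; the superlevel set of the composite thus sits inside one of
  \<open>f\<close>.\<close>

lemma C0_compose:
  assumes f: "f \<in> C0 X" and h: "continuous_on UNIV h" "h 0 = 0"
  shows "(\<lambda>t. h (f t)) \<in> C0 X"
proof (rule C0_intro)
  show "continuous_map X euclidean (\<lambda>t. h (f t))"
    using continuous_map_compose[OF C0_continuous[OF f], of euclidean h] h(1)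
    by (simp add: o_def continuous_map_iff_continuous2)
  show "h (f t) = 0" if "t \<notin> topspace X" for t
    using that h(2) by (simp add: C0_outside[OF f])
  fix \<epsilon> :: real assume \<epsilon>: "\<epsilon> > 0"
  obtain \<delta> where \<delta>: "\<delta> > 0" "\<And>z. dist z 0 < \<delta> \<Longrightarrow> dist (h z) (h 0) < \<epsilon>"
    using h(1) \<epsilon> unfolding continuous_on_iff by (metis UNIV_I)
  have "\<delta> \<le> cmod z" if "\<epsilon> \<le> cmod (h z)" for z
    using \<delta>(2)[of z] that h(2) by (fastforce simp: dist_norm)
  then show "\<exists>C. compactin X C \<and> {t \<in> topspace X. \<epsilon> \<le> cmod (h (f t))} \<subseteq> C"
    using C0_compactin[OF f \<delta>(1)] by blast
qed

abbreviation C0u :: "'k topology \<Rightarrow> ('k \<Rightarrow> complex) set" where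
  "C0u X \<equiv> carrier (C0_unitalization X)"

lemma C0u_iff: "a \<in> C0u X \<longleftrightarrow> (\<exists>f\<in>C0 X. \<exists>c. a = (\<lambda>t. f t + c * indicator (topspace X) t))"
  by (auto simp: C0_unitalization_def)

lemma C0u_sel [simp]:
  "f \<otimes>\<^bsub>C0_unitalization X\<^esub> g = (\<lambda>t. f t * g t)"
  "f \<oplus>\<^bsub>C0_unitalization X\<^esub> g = (\<lambda>t. f t + g t)"
  "\<one>\<^bsub>C0_unitalization X\<^esub> = indicator (topspace X)"
  "\<zero>\<^bsub>C0_unitalization X\<^esub> = (\<lambda>t. 0)"
  "scl (C0_unitalization X) c f = (\<lambda>t. c * f t)"
  "adj (C0_unitalization X) f = (\<lambda>t. cnj (f t))"
  "nrm (C0_unitalization X) f = (SUP t\<in>topspace X. cmod (f t))"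
  by (simp_all add: C0_unitalization_def)

lemma C0_subset_C0u: "f \<in> C0 X \<Longrightarrow> f \<in> C0u X"
  unfolding C0u_iff by (intro bexI[of _ f] exI[of _ 0]) auto

lemma zero_in_C0u: "(\<lambda>t. 0) \<in> C0u X"
  by (intro C0_subset_C0u zero_in_C0)

lemma one_in_C0u: "indicator (topspace X) \<in> C0u X"
  unfolding C0u_iff by (intro bexI[of _ "\<lambda>t. 0"] exI[of _ 1] zero_in_C0) auto

lemma C0u_bounded:
  assumes "a \<in> C0u X"
  obtains M where "M > 0" "\<And>t. cmod (a t) \<le> M"
proof -
  obtain f c where f: "f \<in> C0 X" and a: "a = (\<lambda>t. f t + c * indicator (topspace X) t)"
    using assms by (auto simp: C0u_iff)
  obtain M where M: "M > 0" "\<And>t. cmod (f t) \<le> M" using C0_bounded[OF f] by blast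
  have "cmod (a t) \<le> M + cmod c" for t
    using norm_triangle_ineq[of "f t" c] M(2)[of t] by (auto simp: a indicator_def intro: add_increasing2)
  moreover have "M + cmod c > 0" using M(1) norm_ge_zero[of c] by linarith
  ultimately show thesis by (rule that[rotated])
qed

lemma C0u_outside: "a \<in> C0u X \<Longrightarrow> t \<notin> topspace X \<Longrightarrow> a t = 0"
  by (auto simp: C0u_iff C0_outside)

lemma C0u_add:
  assumes "a \<in> C0u X" "b \<in> C0u X"
  shows "(\<lambda>t. a t + b t) \<in> C0u X"
proof -
  obtain f c g d where f: "f \<in> C0 X" "g \<in> C0 X"
    and a: "a = (\<lambda>t. f t + c * indicator (topspace X) t)" "b = (\<lambda>t. g t + d * indicator (topspace X) t)"
    using assms by (auto simp: C0u_iff)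
  show ?thesis unfolding C0u_iff
    by (intro bexI[of _ "\<lambda>t. f t + g t"] exI[of _ "c + d"] C0_add f) (auto simp: a algebra_simps)
qed

text \<open>\<open>h\<close> need not vanish at \<open>0\<close>: the value at infinity is absorbed by the unit.\<close>

lemma C0u_compose:
  assumes a: "a \<in> C0u X" and h: "continuous_on UNIV h"
  shows "(\<lambda>t. h (a t) * indicator (topspace X) t) \<in> C0u X"
proof -
  obtain f c where f: "f \<in> C0 X" and a: "a = (\<lambda>t. f t + c * indicator (topspace X) t)"
    using a by (auto simp: C0u_iff)
  have "(\<lambda>t. h (f t + c) - h c) \<in> C0 X"
    by (rule C0_compose[OF f, of "\<lambda>z. h (z + c) - h c"])
      (auto intro!: continuous_intros continuous_on_compose2[OF h])
  then show ?thesis unfolding C0u_iff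
    by (intro bexI[of _ "\<lambda>t. h (f t + c) - h c"] exI[of _ "h c"])
      (auto simp: a indicator_def fun_eq_iff C0_outside[OF f])
qed

text \<open>With \<open>h 0 = 0\<close> the cut-off by the indicator is automatic. Scalar multiples,
  conjugates, negatives and squares are all instances.\<close>

lemma C0u_compose_zero:
  assumes a: "a \<in> C0u X" and h: "continuous_on UNIV h" "h 0 = 0"
  shows "(\<lambda>t. h (a t)) \<in> C0u X"
proof -
  have "(\<lambda>t. h (a t)) = (\<lambda>t. h (a t) * indicator (topspace X) t)"
  proof
    show "h (a t) = h (a t) * indicator (topspace X) t" for t
      using C0u_outside[OF a, of t] h(2) by (cases "t \<in> topspace X") auto
  qed
  then show ?thesis using C0u_compose[OF a h(1)] by simp
qed

lemma C0u_scale: "a \<in> C0u X \<Longrightarrow> (\<lambda>t. c * a t) \<in> C0u X"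
  by (rule C0u_compose_zero) (auto intro!: continuous_intros)

lemma C0u_cnj: "a \<in> C0u X \<Longrightarrow> (\<lambda>t. cnj (a t)) \<in> C0u X"
  by (rule C0u_compose_zero) (auto intro!: continuous_intros)

lemma C0u_uminus: "a \<in> C0u X \<Longrightarrow> (\<lambda>t. - a t) \<in> C0u X"
  by (rule C0u_compose_zero) (auto intro!: continuous_intros)

lemma C0u_diff: "a \<in> C0u X \<Longrightarrow> b \<in> C0u X \<Longrightarrow> (\<lambda>t. a t - b t) \<in> C0u X"
  using C0u_add[OF _ C0u_uminus, of a X b] by simp

text \<open>Polarization writes a product as a difference of two squares, so closure under
  composition with one-variable functions is enough.\<close>

lemma C0u_mult:
  assumes "a \<in> C0u X" "b \<in> C0u X"
  shows "(\<lambda>t. a t * b t) \<in> C0u X"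
proof -
  have sq: "(\<lambda>t. (u t)\<^sup>2) \<in> C0u X" if "u \<in> C0u X" for u
    using that by (rule C0u_compose_zero) (auto intro!: continuous_intros)
  have "(\<lambda>t. a t * b t) = (\<lambda>t. 1/4 * ((a t + b t)\<^sup>2 - (a t - b t)\<^sup>2))"
    by (auto simp: power2_eq_square algebra_simps)
  also have "\<dots> \<in> C0u X"
    by (intro C0u_scale C0u_diff sq C0u_add assms)
  finally show ?thesis .
qed

text \<open>This gives access to the library facts that evaluate \<ominus> and \<open>finsum\<close>
  as pointwise operations.\<close>

lemma abelian_group_C0u: "abelian_group (C0_unitalization X)"
proof (rule abelian_groupI)
  fix a assume a: "a \<in> C0u X"
  show "\<exists>b\<in>C0u X. b \<oplus>\<^bsub>C0_unitalization X\<^esub> a = \<zero>\<^bsub>C0_unitalization X\<^esub>"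
    by (rule bexI[OF _ C0u_uminus[OF a]]) simp
qed (auto simp: C0u_add zero_in_C0u algebra_simps)

lemma C0u_minus [simp]:
  assumes "a \<in> C0u X" "b \<in> C0u X"
  shows "a \<ominus>\<^bsub>C0_unitalization X\<^esub> b = (\<lambda>t. a t - b t)"
proof -
  interpret abelian_group "C0_unitalization X" by (rule abelian_group_C0u)
  have "\<ominus>\<^bsub>C0_unitalization X\<^esub> b = (\<lambda>t. - b t)"
    by (rule minus_equality) (simp_all add: assms C0u_uminus)
  then show ?thesis by (simp add: minus_eq)
qed

lemma C0u_finsum:
  assumes "\<And>j. j \<in> F \<Longrightarrow> a j \<in> C0u X"
  shows "finsum (C0_unitalization X) a F = (\<lambda>t. \<Sum>j\<in>F. a j t)"
proof -
  interpret abelian_group "C0_unitalization X" by (rule abelian_group_C0u)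
  show ?thesis
    using assms
  proof (induction F rule: infinite_finite_induct)
    case (insert j F)
    then show ?case by (subst finsum_insert) auto
  \<comment> \<open>For infinite \<open>F\<close> both sums are zero by convention.\<close>
  qed (simp_all add: finsum_infinite)
qed

section \<open>Frame sums in the module, and standard frames\<close>

lemma C0_module_sel [simp]:
  "carrier (C0_module X) = C0 X"
  "mip (C0_module X) f g = (\<lambda>t. cnj (f t) * g t)"
  by (simp_all add: C0_module_def)

lemma mip_in_C0u: "f \<in> C0 X \<Longrightarrow> g \<in> C0 X \<Longrightarrow> (\<lambda>t. cnj (f t) * g t) \<in> C0u X"
  by (intro C0u_mult C0u_cnj C0_subset_C0u)

lemma frame_partial_sum_C0:
  assumes "y \<in> C0 X" and "\<And>j. j \<in> F \<Longrightarrow> x j \<in> C0 X"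
  shows "frame_partial_sum (C0_unitalization X) (C0_module X) x y F =
      (\<lambda>t. \<Sum>j\<in>F. of_real ((cmod (y t))\<^sup>2 * (cmod (x j t))\<^sup>2))"
    and "frame_partial_sum (C0_unitalization X) (C0_module X) x y F \<in> C0u X"
proof -
  have mem: "(\<lambda>t. cnj (y t) * x j t * (cnj (x j t) * y t)) \<in> C0u X" if "j \<in> F" for j
    using assms that by (intro C0u_mult[OF mip_in_C0u mip_in_C0u]) auto
  then have *: "frame_partial_sum (C0_unitalization X) (C0_module X) x y F =
      (\<lambda>t. \<Sum>j\<in>F. cnj (y t) * x j t * (cnj (x j t) * y t))"
    unfolding frame_partial_sum_def by (subst C0u_finsum) auto
  then show "frame_partial_sum (C0_unitalization X) (C0_module X) x y F =
      (\<lambda>t. \<Sum>j\<in>F. of_real ((cmod (y t))\<^sup>2 * (cmod (x j t))\<^sup>2))"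
    by (simp only: of_real_mult complex_norm_square mult_ac)
  interpret abelian_group "C0_unitalization X" by (rule abelian_group_C0u)
  show "frame_partial_sum (C0_unitalization X) (C0_module X) x y F \<in> C0u X"
    unfolding frame_partial_sum_def using mem by (intro finsum_closed) auto
qed

text \<open>The norm is the supremum norm, so norm convergence is in particular pointwise, and a
  difference \<open>d\<^sup>* d\<close> has nonnegative values. The conclusion is phrased so that
  non-standard frames can share it.\<close>

lemma standard_frame_C0_has_sum:
  assumes "standard_frame (C0_unitalization X) (C0_module X) J x"
  shows "\<exists>c::real>0. \<forall>y\<in>C0 X. \<forall>t\<in>topspace X.
      \<exists>s. ((\<lambda>j. complex_of_real ((cmod (y t))\<^sup>2 * (cmod (x j t))\<^sup>2)) has_sum s) J \<and>
          s - of_real (c * (cmod (y t))\<^sup>2) \<in> \<real>\<^sub>\<ge>\<^sub>0"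
proof -
  let ?A = "C0_unitalization X" and ?S = "frame_partial_sum (C0_unitalization X) (C0_module X) x"
  have x: "\<And>j. j \<in> J \<Longrightarrow> x j \<in> C0 X"
    using assms by (auto simp: standard_frame_def)
  obtain c c' where c: "c > 0"
    and "\<forall>y\<in>carrier (C0_module X). \<exists>s\<in>C0u X.
        ((\<lambda>F. nrm ?A (?S y F \<ominus>\<^bsub>?A\<^esub> s)) \<longlongrightarrow> 0) (finite_subsets_at_top J) \<and>
        alg_le ?A (scl ?A (of_real c) (mip (C0_module X) y y)) s \<and>
        alg_le ?A s (scl ?A (of_real c') (mip (C0_module X) y y))"
    using assms unfolding standard_frame_def by (elim conjE exE) simp
  then have frame: "\<exists>s\<in>C0u X.
        ((\<lambda>F. nrm ?A (?S y F \<ominus>\<^bsub>?A\<^esub> s)) \<longlongrightarrow> 0) (finite_subsets_at_top J) \<and>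
        alg_le ?A (scl ?A (of_real c) (mip (C0_module X) y y)) s" if "y \<in> C0 X" for y
    using that unfolding C0_module_sel(1) by blast
  have "\<exists>s. ((\<lambda>j. complex_of_real ((cmod (y t))\<^sup>2 * (cmod (x j t))\<^sup>2)) has_sum s) J \<and>
      s - of_real (c * (cmod (y t))\<^sup>2) \<in> \<real>\<^sub>\<ge>\<^sub>0" if y: "y \<in> C0 X" and t: "t \<in> topspace X" for y t
  proof -
    obtain s where s: "s \<in> C0u X"
      and lim: "((\<lambda>F. nrm ?A (?S y F \<ominus>\<^bsub>?A\<^esub> s)) \<longlongrightarrow> 0) (finite_subsets_at_top J)"
      and le: "alg_le ?A (scl ?A (of_real c) (mip (C0_module X) y y)) s"
      using frame[OF y] by blast
    have "((\<lambda>F. ?S y F t - s t) \<longlongrightarrow> 0) (finite_subsets_at_top J)"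
    proof (rule Lim_null_comparison[OF _ lim])
      have "cmod (?S y F t - s t) \<le> nrm ?A (?S y F \<ominus>\<^bsub>?A\<^esub> s)" if F: "F \<subseteq> J" for F
      proof -
        have S: "?S y F \<in> C0u X" using x F y by (intro frame_partial_sum_C0) auto
        \<comment> \<open>The supremum in \<open>nrm\<close> dominates the value at \<open>t\<close>
          only because the function is bounded.\<close>
        obtain M where M: "\<And>t. cmod (?S y F t - s t) \<le> M"
          using C0u_bounded[OF C0u_diff[OF S s]] by blast
        have "cmod (?S y F t - s t) \<le> (SUP t\<in>topspace X. cmod (?S y F t - s t))"
          by (rule cSUP_upper[OF t]) (auto intro!: bdd_aboveI[of _ M] M)
        then show ?thesis using S s by simp
      qed
      then show "\<forall>\<^sub>F F in finite_subsets_at_top J. cmod (?S y F t - s t) \<le> nrm ?A (?S y F \<ominus>\<^bsub>?A\<^esub> s)"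
        by (intro eventually_finite_subsets_at_top_weakI)
    qed
    then have "((\<lambda>F. ?S y F t) \<longlongrightarrow> s t) (finite_subsets_at_top J)"
      by (rule Lim_null[THEN iffD2])
    moreover have "\<forall>\<^sub>F F in finite_subsets_at_top J. ?S y F t =
        (\<Sum>j\<in>F. complex_of_real ((cmod (y t))\<^sup>2 * (cmod (x j t))\<^sup>2))"
      using x by (intro eventually_finite_subsets_at_top_weakI)
        (subst frame_partial_sum_C0(1)[OF y], auto)
    ultimately have "((\<lambda>j. complex_of_real ((cmod (y t))\<^sup>2 * (cmod (x j t))\<^sup>2)) has_sum s t) J"
      unfolding has_sum_def by (rule Lim_transform_eventually)
    moreover obtain d where "(\<lambda>t. s t - of_real c * (cnj (y t) * y t)) = (\<lambda>t. cnj (d t) * d t)"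
      using le s mip_in_C0u[OF y y] by (auto simp: alg_le_def C0u_scale)
    then have "s t - of_real c * (cnj (y t) * y t) = cnj (d t) * d t"
      by (rule fun_cong)
    then have "s t - of_real (c * (cmod (y t))\<^sup>2) = of_real ((cmod (d t))\<^sup>2)"
      by (simp only: of_real_mult complex_norm_square mult.commute)
    then have "s t - of_real (c * (cmod (y t))\<^sup>2) \<in> \<real>\<^sub>\<ge>\<^sub>0"
      by (simp only: nonneg_Reals_of_real_iff) simp
    ultimately show ?thesis by blast
  qed
  with c show ?thesis by blast
qed

section \<open>States and their GNS spaces\<close>

abbreviation C0_states :: "'k topology \<Rightarrow> (('k \<Rightarrow> complex) \<Rightarrow> complex) set" where
  "C0_states X \<equiv> states (C0_unitalization X)"

text \<open>The squared GNS seminorm, matching the squared distance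
  \<open>gns_dist2\<close>.\<close>

definition state_sq :: "(('k \<Rightarrow> complex) \<Rightarrow> complex) \<Rightarrow> ('k \<Rightarrow> complex) \<Rightarrow> real" where
  "state_sq \<phi> a = Re (\<phi> (\<lambda>t. cnj (a t) * a t))"

context
  fixes X :: "'k topology" and \<phi>
  assumes \<phi>: "\<phi> \<in> C0_states X"
begin

lemma C0_state_add: "a \<in> C0u X \<Longrightarrow> b \<in> C0u X \<Longrightarrow> \<phi> (\<lambda>t. a t + b t) = \<phi> a + \<phi> b"
  using \<phi> by (simp add: states_def)

lemma C0_state_scale: "a \<in> C0u X \<Longrightarrow> \<phi> (\<lambda>t. c * a t) = c * \<phi> a"
  using \<phi> by (simp add: states_def)

lemma C0u_sq: "a \<in> C0u X \<Longrightarrow> (\<lambda>t. cnj (a t) * a t) \<in> C0u X"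
  by (intro C0u_mult C0u_cnj)

lemma C0_state_nonneg: "a \<in> C0u X \<Longrightarrow> \<phi> (\<lambda>t. cnj (a t) * a t) \<in> \<real>\<^sub>\<ge>\<^sub>0"
  using \<phi> by (simp add: states_def)

lemma C0_state_sq: "a \<in> C0u X \<Longrightarrow> \<phi> (\<lambda>t. cnj (a t) * a t) = of_real (state_sq \<phi> a)"
  using C0_state_nonneg by (force simp: state_sq_def complex_nonneg_Reals_iff complex_eq_iff)

lemma state_sq_nonneg: "a \<in> C0u X \<Longrightarrow> state_sq \<phi> a \<ge> 0"
  using C0_state_nonneg[of a] by (simp add: state_sq_def complex_nonneg_Reals_iff)

lemma state_sq_scale:
  assumes "a \<in> C0u X"
  shows "state_sq \<phi> (\<lambda>t. c * a t) = (cmod c)\<^sup>2 * state_sq \<phi> a"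
proof -
  have "(\<lambda>t. cnj (c * a t) * (c * a t)) = (\<lambda>t. of_real ((cmod c)\<^sup>2) * (cnj (a t) * a t))"
    by (simp only: complex_norm_square complex_cnj_mult mult_ac)
  then have "\<phi> (\<lambda>t. cnj (c * a t) * (c * a t)) = of_real ((cmod c)\<^sup>2) * \<phi> (\<lambda>t. cnj (a t) * a t)"
    using C0_state_scale[OF C0u_sq[OF assms]] by metis
  then show ?thesis
    by (simp only: state_sq_def times_complex.sel Re_complex_of_real Im_complex_of_real
        mult_zero_left diff_zero)
qed

lemma state_sq_zero: "state_sq \<phi> (\<lambda>t. 0) = 0"
  using state_sq_scale[OF zero_in_C0u, of 0] by simp

text \<open>The parallelogram law with the term for the difference dropped; it serves as triangle
  inequality for the squared seminorm.\<close>

lemma state_sq_add_le: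
  assumes a: "a \<in> C0u X" and b: "b \<in> C0u X"
  shows "state_sq \<phi> (\<lambda>t. a t + b t) \<le> 2 * state_sq \<phi> a + 2 * state_sq \<phi> b"
proof -
  note ab = C0u_add[OF a b] C0u_diff[OF a b]
  have "\<phi> (\<lambda>t. cnj (a t + b t) * (a t + b t)) + \<phi> (\<lambda>t. cnj (a t - b t) * (a t - b t))
      = \<phi> (\<lambda>t. cnj (a t + b t) * (a t + b t) + cnj (a t - b t) * (a t - b t))"
    by (rule C0_state_add[symmetric]; intro C0u_sq ab)
  also have "\<dots> = \<phi> (\<lambda>t. 2 * (cnj (a t) * a t) + 2 * (cnj (b t) * b t))"
    by (simp add: algebra_simps)
  also have "\<dots> = 2 * \<phi> (\<lambda>t. cnj (a t) * a t) + 2 * \<phi> (\<lambda>t. cnj (b t) * b t)"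
    by (simp add: C0_state_add C0_state_scale C0u_scale C0u_sq a b)
  finally have "complex_of_real (state_sq \<phi> (\<lambda>t. a t + b t)) + of_real (state_sq \<phi> (\<lambda>t. a t - b t))
      = 2 * of_real (state_sq \<phi> a) + 2 * of_real (state_sq \<phi> b)"
    unfolding C0_state_sq[OF a] C0_state_sq[OF b] C0_state_sq[OF ab(1)] C0_state_sq[OF ab(2)] .
  then have "complex_of_real (state_sq \<phi> (\<lambda>t. a t + b t) + state_sq \<phi> (\<lambda>t. a t - b t))
      = of_real (2 * state_sq \<phi> a + 2 * state_sq \<phi> b)"
    by simp
  then have "state_sq \<phi> (\<lambda>t. a t + b t) + state_sq \<phi> (\<lambda>t. a t - b t)
      = 2 * state_sq \<phi> a + 2 * state_sq \<phi> b"
    unfolding of_real_eq_iff .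
  then show ?thesis using state_sq_nonneg[OF ab(2)] by linarith
qed

text \<open>Polarization gives a bound by a sum, which suffices in place of Cauchy--Schwarz after rescaling
  \<open>a\<close> and \<open>b\<close> by reciprocal factors.\<close>

lemma C0_state_cross_bound:
  assumes a: "a \<in> C0u X" and b: "b \<in> C0u X"
  shows "cmod (\<phi> (\<lambda>t. cnj (a t) * b t)) \<le> 2 * state_sq \<phi> a + 2 * state_sq \<phi> b"
proof -
  define p where "p c = (\<lambda>t. a t + c * b t)" for c
  have p: "p c \<in> C0u X" for c unfolding p_def by (intro C0u_add C0u_scale a b)
  have bound: "state_sq \<phi> (p c) \<le> 2 * state_sq \<phi> a + 2 * state_sq \<phi> b" if "cmod c = 1" for c
    using state_sq_add_le[OF a C0u_scale[OF b, of c]] state_sq_scale[OF b, of c] that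
    by (simp add: p_def)
  have nq: "cmod (\<phi> (\<lambda>t. c * (cnj (p d t) * p d t))) = cmod c * state_sq \<phi> (p d)" for c d
    unfolding C0_state_scale[OF C0u_sq[OF p]] C0_state_sq[OF p] norm_mult norm_of_real
    using state_sq_nonneg[OF p] by simp
  let ?q = "\<lambda>c d t. c * (cnj (p d t) * p d t)"
  have q: "?q c d \<in> C0u X" for c d by (intro C0u_scale C0u_sq p)
  \<comment> \<open>\<open>?q c d\<close> is \<open>|a + d b|^2\<close> weighted by
    \<open>c\<close>, the conjugate of the unit \<open>d\<close>. Summed over the four units, every
    term other than the conjugate of \<open>a\<close> times \<open>b\<close> cancels.\<close>
  have "(\<lambda>t. 4 * (cnj (a t) * b t)) =
      (\<lambda>t. (?q 1 1 t + ?q (-1) (-1) t) + (?q \<i> (-\<i>) t + ?q (-\<i>) \<i> t))"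
    by (auto simp: p_def fun_eq_iff algebra_simps)
  then have "4 * \<phi> (\<lambda>t. cnj (a t) * b t) =
      \<phi> (\<lambda>t. (?q 1 1 t + ?q (-1) (-1) t) + (?q \<i> (-\<i>) t + ?q (-\<i>) \<i> t))"
    using C0_state_scale[OF C0u_mult[OF C0u_cnj[OF a] b], of 4] by metis
  also have "\<dots> = (\<phi> (?q 1 1) + \<phi> (?q (-1) (-1))) + (\<phi> (?q \<i> (-\<i>)) + \<phi> (?q (-\<i>) \<i>))"
    by (simp only: C0_state_add C0u_add q)
  finally have "cmod (4 * \<phi> (\<lambda>t. cnj (a t) * b t)) =
      cmod ((\<phi> (?q 1 1) + \<phi> (?q (-1) (-1))) + (\<phi> (?q \<i> (-\<i>)) + \<phi> (?q (-\<i>) \<i>)))"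
    by (rule arg_cong)
  also have "\<dots> \<le> (cmod (\<phi> (?q 1 1)) + cmod (\<phi> (?q (-1) (-1)))) +
      (cmod (\<phi> (?q \<i> (-\<i>))) + cmod (\<phi> (?q (-\<i>) \<i>)))"
    by (intro order_trans[OF norm_triangle_ineq] add_mono norm_triangle_ineq)
  also have "\<dots> = state_sq \<phi> (p 1) + state_sq \<phi> (p (-1)) + (state_sq \<phi> (p (-\<i>)) + state_sq \<phi> (p \<i>))"
    unfolding nq by simp
  also have "\<dots> \<le> 4 * (2 * state_sq \<phi> a + 2 * state_sq \<phi> b)"
    using bound[of 1] bound[of "-1"] bound[of "\<i>"] bound[of "-\<i>"] by simp
  finally show ?thesis by (simp add: norm_mult)
qed

text \<open>Replacing \<open>a\<close> by \<open>sqrt r * a\<close> and \<open>b\<close> by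
  \<open>b / sqrt r\<close> leaves the cross term unchanged but trades the two seminorms against
  each other: a large \<open>r\<close> controls the bounded factor, and the null sequence then
  absorbs \<open>r\<close>.\<close>

lemma C0_state_cross_tendsto_0:
  assumes a: "\<And>n. a n \<in> C0u X" and b: "\<And>n. b n \<in> C0u X"
    and lim: "(\<lambda>n. state_sq \<phi> (a n)) \<longlonglongrightarrow> 0"
    and bdd: "eventually (\<lambda>n. state_sq \<phi> (b n) \<le> B) sequentially"
  shows "(\<lambda>n. \<phi> (\<lambda>t. cnj (a n t) * b n t)) \<longlonglongrightarrow> 0"
proof (rule tendstoI)
  fix \<epsilon> :: real assume \<epsilon>: "\<epsilon> > 0"
  \<comment> \<open>Chosen so that \<open>2 * B / r \<le> \<epsilon> / 2\<close>; the absolute value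
    and the added 1 keep \<open>r\<close> positive for every \<open>B\<close>.\<close>
  define r where "r = (4 * \<bar>B\<bar> + 1) / \<epsilon>"
  have r: "r > 0" using \<epsilon> by (simp add: r_def add_nonneg_pos)
  have "4 * B \<le> \<epsilon> * r" using \<epsilon> by (simp add: r_def)
  then have rB: "2 * B / r \<le> \<epsilon> / 2"
    using r by (simp add: field_simps)
  have scaled: "cmod (\<phi> (\<lambda>t. cnj (a n t) * b n t)) \<le> 2 * (r * state_sq \<phi> (a n)) + 2 * (state_sq \<phi> (b n) / r)" for n
  proof -
    let ?l = "complex_of_real (sqrt r)"
    have l: "?l \<noteq> 0" "(cmod ?l)\<^sup>2 = r" "(cmod (1 / ?l))\<^sup>2 = 1 / r"
      using r by (auto simp: norm_divide power_divide)
    have "cnj (?l * z) * (1 / ?l * w) = cnj z * w" for z w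
      using l(1) by simp
    then show ?thesis
      using C0_state_cross_bound[OF C0u_scale[OF a, of ?l n] C0u_scale[OF b, of "1 / ?l" n]]
      by (simp only: state_sq_scale[OF a] state_sq_scale[OF b] l(2,3)) simp
  qed
  have "eventually (\<lambda>n. state_sq \<phi> (a n) < \<epsilon> / (4 * r)) sequentially"
    using order_tendstoD(2)[OF lim] \<epsilon> r by simp
  then show "\<forall>\<^sub>F n in sequentially. dist (\<phi> (\<lambda>t. cnj (a n t) * b n t)) 0 < \<epsilon>"
    using bdd
  proof eventually_elim
    case (elim n)
    have "2 * (r * state_sq \<phi> (a n)) < \<epsilon> / 2"
      using elim(1) r by (simp add: field_simps)
    moreover have "2 * (state_sq \<phi> (b n) / r) \<le> 2 * B / r"
      using elim(2) r by (simp add: divide_right_mono)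
    ultimately show ?case using scaled[of n] rB by simp
  qed
qed

text \<open>\<open>M\<^sup>2 - a\<^sup>* a\<close> has a square root in the unitalization, so \<open>a\<close> acts on the GNS space with
  norm at most \<open>M\<close>.\<close>

lemma state_sq_mult_le:
  assumes a: "a \<in> C0u X" and s: "s \<in> C0u X" and M: "\<And>t. cmod (a t) \<le> M"
  shows "state_sq \<phi> (\<lambda>t. a t * s t) \<le> M\<^sup>2 * state_sq \<phi> s"
proof -
  \<comment> \<open>\<open>sqrt\<close> is continuous on all reals, negative ones included, so
    \<open>C0u_compose\<close> applies with a function defined on the whole plane. Its value at 0 is
    \<open>sqrt (M\<^sup>2)\<close>, hence the indicator.\<close>
  define d where "d t = of_real (sqrt (M\<^sup>2 - (cmod (a t))\<^sup>2)) * (indicator (topspace X) t :: complex)" for t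
  have d: "d \<in> C0u X"
    unfolding d_def by (rule C0u_compose[OF a]) (intro continuous_intros)
  have "cnj (a t * s t) * (a t * s t) + cnj (d t * s t) * (d t * s t) = of_real (M\<^sup>2) * (cnj (s t) * s t)" for t
  proof (cases "t \<in> topspace X")
    case True
    have "(cmod (a t))\<^sup>2 \<le> M\<^sup>2" using M[of t] by (simp add: power_mono)
    then have "cnj (d t) * d t = of_real (M\<^sup>2 - (cmod (a t))\<^sup>2)"
      using True by (simp add: d_def flip: of_real_mult)
    also have "\<dots> = of_real (M\<^sup>2) - cnj (a t) * a t"
      by (simp only: of_real_diff complex_norm_square mult.commute)
    finally have "cnj (d t) * d t = of_real (M\<^sup>2) - cnj (a t) * a t" .
    moreover have "cnj (a t * s t) * (a t * s t) + cnj (d t * s t) * (d t * s t)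
        = (cnj (a t) * a t + cnj (d t) * d t) * (cnj (s t) * s t)"
      by (simp add: algebra_simps)
    ultimately show ?thesis by simp
  qed (simp add: C0u_outside[OF s])
  then have "\<phi> (\<lambda>t. cnj (a t * s t) * (a t * s t) + cnj (d t * s t) * (d t * s t))
      = of_real (M\<^sup>2) * \<phi> (\<lambda>t. cnj (s t) * s t)"
    using C0_state_scale[OF C0u_sq[OF s], of "of_real (M\<^sup>2)"] by simp
  moreover have "\<phi> (\<lambda>t. cnj (a t * s t) * (a t * s t) + cnj (d t * s t) * (d t * s t))
      = \<phi> (\<lambda>t. cnj (a t * s t) * (a t * s t)) + \<phi> (\<lambda>t. cnj (d t * s t) * (d t * s t))"
    by (rule C0_state_add; intro C0u_sq C0u_mult a d s)
  ultimately have "of_real (state_sq \<phi> (\<lambda>t. a t * s t)) + of_real (state_sq \<phi> (\<lambda>t. d t * s t))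
      = of_real (M\<^sup>2) * complex_of_real (state_sq \<phi> s)"
    by (simp only: C0_state_sq[OF C0u_mult[OF a s]] C0_state_sq[OF C0u_mult[OF d s]] C0_state_sq[OF s])
  then have "state_sq \<phi> (\<lambda>t. a t * s t) + state_sq \<phi> (\<lambda>t. d t * s t) = M\<^sup>2 * state_sq \<phi> s"
    by (simp only: of_real_eq_iff flip: of_real_add of_real_mult)
  then show ?thesis using state_sq_nonneg[OF C0u_mult[OF d s]] by linarith
qed

end

section \<open>GNS spaces and their chosen representatives\<close>

abbreviation C0_gns_Cauchy where "C0_gns_Cauchy X \<equiv> gns_Cauchy (C0_unitalization X)"
abbreviation C0_gns_rel where "C0_gns_rel X \<equiv> gns_rel (C0_unitalization X)"
abbreviation C0_gns where "C0_gns X \<equiv> gns_space (C0_unitalization X)"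

lemma gns_dist2_C0u:
  "a \<in> C0u X \<Longrightarrow> b \<in> C0u X \<Longrightarrow>
    gns_dist2 (C0_unitalization X) \<phi> a b = state_sq \<phi> (\<lambda>t. a t - b t)"
  by (simp add: gns_dist2_def state_sq_def)

lemma C0_gns_CauchyD: "s \<in> C0_gns_Cauchy X \<phi> \<Longrightarrow> s n \<in> C0u X"
  by (simp add: gns_Cauchy_def)

lemma C0_gns_Cauchy_iff:
  assumes "\<And>n. s n \<in> C0u X"
  shows "s \<in> C0_gns_Cauchy X \<phi> \<longleftrightarrow>
    (\<forall>\<epsilon>>0. \<exists>N. \<forall>m\<ge>N. \<forall>n\<ge>N. state_sq \<phi> (\<lambda>t. s m t - s n t) < \<epsilon>)"
  using assms by (simp add: gns_Cauchy_def gns_dist2_C0u)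

lemma C0_gns_relD:
  assumes "(s, r) \<in> C0_gns_rel X \<phi>"
  shows "s \<in> C0_gns_Cauchy X \<phi>" "r \<in> C0_gns_Cauchy X \<phi>"
    "(\<lambda>n. state_sq \<phi> (\<lambda>t. s n t - r n t)) \<longlonglongrightarrow> 0"
  using assms by (auto simp: gns_rel_def gns_dist2_C0u C0_gns_CauchyD)

context
  fixes X :: "'k topology" and \<phi>
  assumes \<phi>: "\<phi> \<in> C0_states X"
begin

lemma const_C0_gns_Cauchy: "a \<in> C0u X \<Longrightarrow> (\<lambda>n. a) \<in> C0_gns_Cauchy X \<phi>"
  by (subst C0_gns_Cauchy_iff) (auto simp: state_sq_zero[OF \<phi>])

text \<open>Reflexivity makes the class nonempty, so the choice in \<open>repr\<close> lands in it.
  Equivalence to \<open>s\<close> is all that is known of the chosen sequence.\<close>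

lemma repr_C0_gns_class:
  assumes s: "s \<in> C0_gns_Cauchy X \<phi>"
  shows "(s, repr (C0_gns_rel X \<phi> `` {s})) \<in> C0_gns_rel X \<phi>"
proof -
  have "(s, s) \<in> C0_gns_rel X \<phi>"
    using s C0_gns_CauchyD[OF s] by (simp add: gns_rel_def gns_dist2_C0u state_sq_zero[OF \<phi>])
  then show ?thesis
    unfolding repr_def using someI[of "\<lambda>r. r \<in> C0_gns_rel X \<phi> `` {s}" s] by blast
qed

lemma C0_gns_class_in_carrier:
  "s \<in> C0_gns_Cauchy X \<phi> \<Longrightarrow> C0_gns_rel X \<phi> `` {s} \<in> carrier (C0_gns X \<phi>)"
  by (auto simp: gns_space_def intro: quotientI)

lemma repr_C0_gns_Cauchy:
  assumes "F \<in> carrier (C0_gns X \<phi>)"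
  shows "repr F \<in> C0_gns_Cauchy X \<phi>"
proof -
  obtain s where "s \<in> C0_gns_Cauchy X \<phi>" "F = C0_gns_rel X \<phi> `` {s}"
    using assms by (auto simp: gns_space_def elim: quotientE)
  then show ?thesis using C0_gns_relD(2)[OF repr_C0_gns_class] by blast
qed

lemma C0_gns_Cauchy_mult:
  assumes a: "a \<in> C0u X" and s: "s \<in> C0_gns_Cauchy X \<phi>"
  shows "(\<lambda>n t. a t * s n t) \<in> C0_gns_Cauchy X \<phi>"
proof (subst C0_gns_Cauchy_iff)
  note sC = C0_gns_CauchyD[OF s]
  show "(\<lambda>t. a t * s n t) \<in> C0u X" for n by (intro C0u_mult a sC)
  obtain M where M: "M > 0" "\<And>t. cmod (a t) \<le> M" using C0u_bounded[OF a] by blast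
  show "\<forall>\<epsilon>>0. \<exists>N. \<forall>m\<ge>N. \<forall>n\<ge>N. state_sq \<phi> (\<lambda>t. a t * s m t - a t * s n t) < \<epsilon>"
  proof (intro allI impI)
    fix \<epsilon> :: real assume "\<epsilon> > 0"
    then have "\<epsilon> / M\<^sup>2 > 0" using M(1) by simp
    then obtain N where N: "\<forall>m\<ge>N. \<forall>n\<ge>N. state_sq \<phi> (\<lambda>t. s m t - s n t) < \<epsilon> / M\<^sup>2"
      using s unfolding C0_gns_Cauchy_iff[OF sC] by blast
    have "state_sq \<phi> (\<lambda>t. a t * s m t - a t * s n t) < \<epsilon>" if "m \<ge> N" "n \<ge> N" for m n
    proof -
      have "state_sq \<phi> (\<lambda>t. a t * (s m t - s n t)) \<le> M\<^sup>2 * state_sq \<phi> (\<lambda>t. s m t - s n t)"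
        by (intro state_sq_mult_le[OF \<phi>] a C0u_diff sC M(2))
      also have "\<dots> < \<epsilon>"
        using N that M(1) by (simp add: field_simps)
      finally show ?thesis by (simp add: right_diff_distrib)
    qed
    then show "\<exists>N. \<forall>m\<ge>N. \<forall>n\<ge>N. state_sq \<phi> (\<lambda>t. a t * s m t - a t * s n t) < \<epsilon>" by blast
  qed
qed

lemma C0_gns_rep_eq:
  "gns_rep (C0_unitalization X) \<phi> a F = C0_gns_rel X \<phi> `` {\<lambda>n t. a t * repr F n t}"
  by (simp add: gns_rep_def)

lemma C0_gns_rep_in_carrier:
  "a \<in> C0u X \<Longrightarrow> F \<in> carrier (C0_gns X \<phi>) \<Longrightarrow>
    gns_rep (C0_unitalization X) \<phi> a F \<in> carrier (C0_gns X \<phi>)"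
  unfolding C0_gns_rep_eq
  by (intro C0_gns_class_in_carrier C0_gns_Cauchy_mult repr_C0_gns_Cauchy)

lemma C0_gns_Cauchy_bounded:
  assumes s: "s \<in> C0_gns_Cauchy X \<phi>"
  obtains B where "eventually (\<lambda>n. state_sq \<phi> (s n) \<le> B) sequentially"
proof -
  note sC = C0_gns_CauchyD[OF s]
  obtain N where N: "\<forall>m\<ge>N. \<forall>n\<ge>N. state_sq \<phi> (\<lambda>t. s m t - s n t) < 1"
    using s unfolding C0_gns_Cauchy_iff[OF sC] by (meson zero_less_one)
  have "state_sq \<phi> (s n) \<le> 2 * 1 + 2 * state_sq \<phi> (s N)" if "n \<ge> N" for n
  proof -
    have "state_sq \<phi> (\<lambda>t. (s n t - s N t) + s N t) \<le> 2 * state_sq \<phi> (\<lambda>t. s n t - s N t) + 2 * state_sq \<phi> (s N)"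
      by (intro state_sq_add_le[OF \<phi>] C0u_diff sC)
    moreover have "state_sq \<phi> (\<lambda>t. s n t - s N t) < 1" using N that by blast
    ultimately show ?thesis by simp
  qed
  then show thesis by (intro that eventually_sequentiallyI)
qed

text \<open>The sequence representing the zero class need not be zero, only null in the seminorm;
  paired with a bounded sequence it still gives limit 0.\<close>

lemma hip_C0_gns_zero:
  assumes G: "G \<in> carrier (C0_gns X \<phi>)"
  shows "hip (C0_gns X \<phi>) (C0_gns_rel X \<phi> `` {\<lambda>n t. 0}) G = 0"
proof -
  define s where "s = repr (C0_gns_rel X \<phi> `` {\<lambda>n t. 0})"
  have rel: "(\<lambda>n t. 0, s) \<in> C0_gns_rel X \<phi>"
    unfolding s_def by (intro repr_C0_gns_class const_C0_gns_Cauchy zero_in_C0u)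
  note sC = C0_gns_CauchyD[OF C0_gns_relD(2)[OF rel]]
  have "state_sq \<phi> (\<lambda>t. 0 - s n t) = state_sq \<phi> (s n)" for n
    by (simp add: state_sq_def)
  then have lim: "(\<lambda>n. state_sq \<phi> (s n)) \<longlonglongrightarrow> 0"
    using C0_gns_relD(3)[OF rel] by simp
  note GC = repr_C0_gns_Cauchy[OF G]
  obtain B where B: "eventually (\<lambda>n. state_sq \<phi> (repr G n) \<le> B) sequentially"
    using C0_gns_Cauchy_bounded[OF GC] by blast
  have "(\<lambda>n. \<phi> (\<lambda>t. cnj (s n t) * repr G n t)) \<longlonglongrightarrow> 0"
    by (rule C0_state_cross_tendsto_0[OF \<phi> sC C0_gns_CauchyD[OF GC] lim B])
  then show ?thesis by (simp add: gns_space_def s_def limI)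
qed

end

section \<open>Point states in the universal representation\<close>

text \<open>Restricted to the carrier because \<open>states\<close> consists of extensional
  functionals.\<close>

definition point_state :: "'k topology \<Rightarrow> 'k \<Rightarrow> ('k \<Rightarrow> complex) \<Rightarrow> complex" where
  "point_state X t = (\<lambda>a\<in>C0u X. a t)"

lemma state_sq_point_state: "a \<in> C0u X \<Longrightarrow> state_sq (point_state X t) a = (cmod (a t))\<^sup>2"
  using C0u_mult[OF C0u_cnj, of a X a]
  by (simp add: state_sq_def point_state_def cmod_power2) (simp add: power2_eq_square)

lemma point_state_in_states:
  assumes t: "t \<in> topspace X"
  shows "point_state X t \<in> C0_states X"
proof -
  have "cnj z * z \<in> \<real>\<^sub>\<ge>\<^sub>0" for z
    by (simp add: complex_nonneg_Reals_iff mult.commute)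
  then show ?thesis
    using t by (simp add: states_def point_state_def C0u_add C0u_scale C0u_mult C0u_cnj one_in_C0u)
qed

text \<open>The seminorm of a point state sees only the value at \<open>t\<close>, so limits at
  \<open>t\<close> do not depend on the representative.\<close>

lemma C0_gns_rel_point_state:
  assumes "(s, r) \<in> C0_gns_rel X (point_state X t)" and s: "(\<lambda>n. s n t) \<longlonglongrightarrow> z"
  shows "(\<lambda>n. r n t) \<longlonglongrightarrow> z"
proof -
  note rel = C0_gns_relD[OF assms(1)]
  have "(\<lambda>n. (cmod (s n t - r n t))\<^sup>2) \<longlonglongrightarrow> 0"
    using rel(3) by (simp add: state_sq_point_state C0u_diff C0_gns_CauchyD[OF rel(1)] C0_gns_CauchyD[OF rel(2)])
  from tendsto_real_sqrt[OF this] have "(\<lambda>n. cmod (s n t - r n t)) \<longlonglongrightarrow> 0"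
    by simp
  then have "(\<lambda>n. s n t - r n t) \<longlonglongrightarrow> 0"
    by (rule tendsto_norm_zero_cancel)
  from tendsto_diff[OF s this] show ?thesis by simp
qed

text \<open>\<open>e\<close> is the cyclic vector, the class of the unit. Two choices intervene:
  \<open>s\<close> for the unit and \<open>r\<close> for \<open>a\<close> times \<open>s\<close>; at
  \<open>t\<close> they tend to 1 and \<open>a t\<close>.\<close>

lemma hip_C0_gns_point_state:
  assumes t: "t \<in> topspace X" and a: "a \<in> C0u X"
  defines "\<phi> \<equiv> point_state X t"
  defines "e \<equiv> C0_gns_rel X \<phi> `` {\<lambda>n. indicator (topspace X)}"
  shows "hip (C0_gns X \<phi>) e (gns_rep (C0_unitalization X) \<phi> a e) = a t"
proof -
  have \<phi>: "\<phi> \<in> C0_states X" unfolding \<phi>_def by (rule point_state_in_states[OF t])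
  define s where "s = repr e"
  define r where "r = repr (gns_rep (C0_unitalization X) \<phi> a e)"
  have s: "(\<lambda>n. indicator (topspace X), s) \<in> C0_gns_rel X \<phi>"
    unfolding s_def e_def by (intro repr_C0_gns_class[OF \<phi>] const_C0_gns_Cauchy[OF \<phi>] one_in_C0u)
  have r: "(\<lambda>n t. a t * s n t, r) \<in> C0_gns_rel X \<phi>"
    unfolding r_def C0_gns_rep_eq[OF \<phi>] s_def[symmetric]
    by (intro repr_C0_gns_class[OF \<phi>] C0_gns_Cauchy_mult[OF \<phi>] a C0_gns_relD(2)[OF s])
  have "(\<lambda>n. s n t) \<longlonglongrightarrow> 1"
    by (rule C0_gns_rel_point_state[OF s[unfolded \<phi>_def]]) (simp add: t)
  moreover from this have "(\<lambda>n. r n t) \<longlonglongrightarrow> a t * 1"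
    by (intro C0_gns_rel_point_state[OF r[unfolded \<phi>_def]] tendsto_intros)
  ultimately have "(\<lambda>n. cnj (s n t) * r n t) \<longlonglongrightarrow> cnj 1 * (a t * 1)"
    by (intro tendsto_intros)
  moreover have "\<phi> (\<lambda>t. cnj (s n t) * r n t) = cnj (s n t) * r n t" for n
    using C0_gns_CauchyD[OF C0_gns_relD(2)[OF s]] C0_gns_CauchyD[OF C0_gns_relD(2)[OF r]]
    by (simp add: \<phi>_def point_state_def C0u_mult C0u_cnj)
  ultimately show ?thesis
    by (simp add: gns_space_def s_def r_def limI)
qed

section \<open>Vectors of the universal space\<close>

abbreviation C0_universal where "C0_universal X \<equiv> universal_space (C0_unitalization X)"

text \<open>The record \<open>hilbert_space\<close> has no field for the zero vector, so it is
  assembled from the zero classes.\<close>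

definition universal_zero :: "'k topology \<Rightarrow> ('k \<Rightarrow> complex) universal_vector" where
  "universal_zero X = (\<lambda>\<phi>\<in>C0_states X. C0_gns_rel X \<phi> `` {\<lambda>n t. 0})"

definition universal_point :: "'k topology \<Rightarrow> 'k \<Rightarrow> ('k \<Rightarrow> complex) universal_vector" where
  "universal_point X t = (universal_zero X)
     (point_state X t := C0_gns_rel X (point_state X t) `` {\<lambda>n. indicator (topspace X)})"

lemma C0_universal_sel:
  "carrier (C0_universal X) =
    {u \<in> (\<Pi>\<^sub>E \<phi>\<in>C0_states X. carrier (C0_gns X \<phi>)).
       (\<lambda>\<phi>. (hnorm (C0_gns X \<phi>) (u \<phi>))\<^sup>2) summable_on C0_states X}"
  "hip (C0_universal X) u v = (\<Sum>\<^sub>\<infinity>\<phi>\<in>C0_states X. hip (C0_gns X \<phi>) (u \<phi>) (v \<phi>))"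
  by (simp_all add: universal_space_def hilbert_sum_def)

lemma hnorm_C0_gns_zero:
  "\<phi> \<in> C0_states X \<Longrightarrow> hnorm (C0_gns X \<phi>) (C0_gns_rel X \<phi> `` {\<lambda>n t. 0}) = 0"
  by (simp add: hnorm_def hip_C0_gns_zero C0_gns_class_in_carrier const_C0_gns_Cauchy zero_in_C0u)

lemma universal_zero_in_carrier: "universal_zero X \<in> carrier (C0_universal X)"
proof -
  have "(\<lambda>\<phi>. (hnorm (C0_gns X \<phi>) (universal_zero X \<phi>))\<^sup>2) summable_on C0_states X
      \<longleftrightarrow> (\<lambda>\<phi>. 0 :: real) summable_on C0_states X"
    by (rule summable_on_cong) (simp add: universal_zero_def hnorm_C0_gns_zero)
  then show ?thesis
    unfolding C0_universal_sel
    by (simp add: universal_zero_def C0_gns_class_in_carrier const_C0_gns_Cauchy zero_in_C0u)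
qed

lemma universal_point_in_PiE:
  assumes "t \<in> topspace X"
  shows "universal_point X t \<in> (\<Pi>\<^sub>E \<phi>\<in>C0_states X. carrier (C0_gns X \<phi>))"
  using point_state_in_states[OF assms]
  by (auto simp: universal_point_def universal_zero_def PiE_def extensional_def
      C0_gns_class_in_carrier const_C0_gns_Cauchy zero_in_C0u one_in_C0u)

lemma universal_point_in_carrier:
  assumes t: "t \<in> topspace X"
  shows "universal_point X t \<in> carrier (C0_universal X)"
proof -
  have "(\<lambda>\<phi>. (hnorm (C0_gns X \<phi>) (universal_point X t \<phi>))\<^sup>2) summable_on C0_states X
      \<longleftrightarrow> (\<lambda>\<phi>. (hnorm (C0_gns X \<phi>) (universal_point X t \<phi>))\<^sup>2) summable_on {point_state X t}"
    using point_state_in_states[OF t]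
    by (intro summable_on_cong_neutral) (auto simp: universal_point_def universal_zero_def hnorm_C0_gns_zero)
  then show ?thesis
    using universal_point_in_PiE[OF t] unfolding C0_universal_sel by simp
qed

text \<open>Phrased through components of \<open>w\<close>, so that it applies to
  \<open>universal_rep\<close> vectors directly, with square summability of the image left
  aside.\<close>

lemma hip_universal_zero:
  assumes "\<And>\<phi>. \<phi> \<in> C0_states X \<Longrightarrow> w \<phi> \<in> carrier (C0_gns X \<phi>)"
  shows "hip (C0_universal X) (universal_zero X) w = 0"
  unfolding C0_universal_sel
  by (rule infsum_0) (simp add: universal_zero_def hip_C0_gns_zero assms)

lemma universal_rep_component_in_carrier:
  assumes "a \<in> C0u X" "u \<in> carrier (C0_universal X)" "\<phi> \<in> C0_states X"
  shows "universal_rep (C0_unitalization X) a u \<phi> \<in> carrier (C0_gns X \<phi>)"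
  using assms by (auto simp: universal_rep_def C0_universal_sel intro!: C0_gns_rep_in_carrier)

text \<open>In every other summand the left vector is the zero class, so the sum over all states
  collapses to the point state.\<close>

lemma hip_universal_point:
  assumes t: "t \<in> topspace X" and a: "a \<in> C0u X"
  shows "hip (C0_universal X) (universal_point X t)
    (universal_rep (C0_unitalization X) a (universal_point X t)) = a t"
proof -
  let ?u = "universal_point X t" and ?p = "point_state X t"
  let ?f = "\<lambda>\<phi>. hip (C0_gns X \<phi>) (?u \<phi>) (universal_rep (C0_unitalization X) a ?u \<phi>)"
  have p: "?p \<in> C0_states X" by (rule point_state_in_states[OF t])
  have "infsum ?f (C0_states X) = infsum ?f {?p}"
  proof (rule infsum_cong_neutral)
    fix \<phi> assume "\<phi> \<in> C0_states X - {?p}"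
    then have "\<phi> \<in> C0_states X" "?u \<phi> = C0_gns_rel X \<phi> `` {\<lambda>n t. 0}"
      by (auto simp: universal_point_def universal_zero_def)
    then show "?f \<phi> = 0"
      using universal_rep_component_in_carrier[OF a universal_point_in_carrier[OF t]]
      by (simp add: hip_C0_gns_zero)
  qed (use p in auto)
  also have "\<dots> = a t"
    using hip_C0_gns_point_state[OF t a] p by (simp add: universal_rep_def universal_point_def)
  finally show ?thesis by (simp add: C0_universal_sel)
qed

text \<open>Tested on the single vector of a point state (padded with zero vectors), ultraweak convergence
  is convergence at that point.\<close>

lemma ultraweak_tendsto_universal_point:
  assumes t: "t \<in> topspace X" and a: "eventually (\<lambda>i. a i \<in> C0u X) \<F>"
    and T: "T \<in> enveloping_vN (C0_unitalization X)"
    and lim: "ultraweak_tendsto (C0_universal X) (\<lambda>i. universal_rep (C0_unitalization X) (a i)) T \<F>"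
  shows "((\<lambda>i. a i t) \<longlongrightarrow> hip (C0_universal X) (universal_point X t) (T (universal_point X t))) \<F>"
proof -
  let ?H = "C0_universal X" and ?R = "universal_rep (C0_unitalization X)"
  let ?u = "universal_point X t" and ?z = "universal_zero X"
  define \<xi> where "\<xi> n = (if n = 0 then ?u else ?z)" for n :: nat
  have \<xi>: "\<xi> \<in> square_summable ?H"
  proof -
    have "hip ?H ?z ?z = 0"
      using universal_zero_in_carrier[of X] by (intro hip_universal_zero) (auto simp: C0_universal_sel(1))
    then have "hnorm ?H ?z = 0" by (simp add: hnorm_def)
    then have "summable (\<lambda>n. (hnorm ?H (\<xi> n))\<^sup>2)"
      by (intro summable_finite[of "{0}"]) (auto simp: \<xi>_def)
    then show ?thesis
      by (simp add: square_summable_def \<xi>_def universal_zero_in_carrier universal_point_in_carrier[OF t])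
  qed
  \<comment> \<open>Stated for general \<open>S\<close> because it serves both the represented
    elements and the limit \<open>T\<close>.\<close>
  have single: "(\<Sum>n. hip ?H (\<xi> n) (S (\<xi> n))) = hip ?H ?u (S ?u)"
    if "\<And>\<phi>. \<phi> \<in> C0_states X \<Longrightarrow> S ?z \<phi> \<in> carrier (C0_gns X \<phi>)" for S
    using that by (subst suminf_finite[of "{0}"]) (auto simp: \<xi>_def hip_universal_zero)
  have "T ?z \<in> carrier ?H"
    using T universal_zero_in_carrier[of X]
    by (auto simp: enveloping_vN_def commutant_def bounded_ops_def)
  then have "(\<Sum>n. hip ?H (\<xi> n) (T (\<xi> n))) = hip ?H ?u (T ?u)"
    by (intro single) (auto simp: C0_universal_sel(1))
  moreover have "eventually (\<lambda>i. (\<Sum>n. hip ?H (\<xi> n) (?R (a i) (\<xi> n))) = a i t) \<F>"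
    using a
  proof eventually_elim
    case (elim i)
    have "(\<Sum>n. hip ?H (\<xi> n) (?R (a i) (\<xi> n))) = hip ?H ?u (?R (a i) ?u)"
      by (intro single universal_rep_component_in_carrier elim universal_zero_in_carrier)
    then show ?case by (simp add: hip_universal_point[OF t elim])
  qed
  moreover have "((\<lambda>i. \<Sum>n. hip ?H (\<xi> n) (?R (a i) (\<xi> n))) \<longlongrightarrow> (\<Sum>n. hip ?H (\<xi> n) (T (\<xi> n)))) \<F>"
    using lim \<xi> by (simp add: ultraweak_tendsto_def)
  ultimately show ?thesis
    using Lim_transform_eventually by fastforce
qed

text \<open>The limit \<open>T\<close> need not come from a function, so its value at
  \<open>t\<close> is replaced by the quadratic form of \<open>T\<close> at
  \<open>universal_point X t\<close>. Testing \<open>op_le\<close> on the same vector yields the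
  lower bound.\<close>

lemma nonstandard_frame_C0_has_sum:
  assumes "nonstandard_frame (C0_unitalization X) (C0_module X) J x"
  shows "\<exists>c::real>0. \<forall>y\<in>C0 X. \<forall>t\<in>topspace X.
      \<exists>s. ((\<lambda>j. complex_of_real ((cmod (y t))\<^sup>2 * (cmod (x j t))\<^sup>2)) has_sum s) J \<and>
          s - of_real (c * (cmod (y t))\<^sup>2) \<in> \<real>\<^sub>\<ge>\<^sub>0"
proof -
  let ?A = "C0_unitalization X" and ?S = "frame_partial_sum (C0_unitalization X) (C0_module X) x"
  let ?H = "C0_universal X"
  have x: "\<And>j. j \<in> J \<Longrightarrow> x j \<in> C0 X"
    using assms by (auto simp: nonstandard_frame_def)
  obtain c c' where c: "c > 0"
    and "\<forall>y\<in>carrier (C0_module X). \<exists>T\<in>enveloping_vN ?A.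
        ultraweak_tendsto ?H (\<lambda>F. universal_rep ?A (?S y F)) T (finite_subsets_at_top J) \<and>
        op_le ?H (universal_rep ?A (scl ?A (of_real c) (mip (C0_module X) y y))) T \<and>
        op_le ?H T (universal_rep ?A (scl ?A (of_real c') (mip (C0_module X) y y)))"
    using assms unfolding nonstandard_frame_def by (elim conjE exE) simp
  then have frame: "\<exists>T\<in>enveloping_vN ?A.
        ultraweak_tendsto ?H (\<lambda>F. universal_rep ?A (?S y F)) T (finite_subsets_at_top J) \<and>
        op_le ?H (universal_rep ?A (scl ?A (of_real c) (mip (C0_module X) y y))) T" if "y \<in> C0 X" for y
    using that unfolding C0_module_sel(1) by blast
  have "\<exists>s. ((\<lambda>j. complex_of_real ((cmod (y t))\<^sup>2 * (cmod (x j t))\<^sup>2)) has_sum s) J \<and>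
      s - of_real (c * (cmod (y t))\<^sup>2) \<in> \<real>\<^sub>\<ge>\<^sub>0" if y: "y \<in> C0 X" and t: "t \<in> topspace X" for y t
  proof -
    obtain T where T: "T \<in> enveloping_vN ?A"
      and lim: "ultraweak_tendsto ?H (\<lambda>F. universal_rep ?A (?S y F)) T (finite_subsets_at_top J)"
      and le: "op_le ?H (universal_rep ?A (scl ?A (of_real c) (mip (C0_module X) y y))) T"
      using frame[OF y] by blast
    let ?u = "universal_point X t"
    let ?s = "hip ?H ?u (T ?u)"
    have "\<forall>\<^sub>F F in finite_subsets_at_top J. ?S y F \<in> C0u X"
      using x by (intro eventually_finite_subsets_at_top_weakI frame_partial_sum_C0(2)[OF y]) auto
    then have "((\<lambda>F. ?S y F t) \<longlongrightarrow> ?s) (finite_subsets_at_top J)"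
      by (rule ultraweak_tendsto_universal_point[OF t _ T lim])
    moreover have "\<forall>\<^sub>F F in finite_subsets_at_top J. ?S y F t =
        (\<Sum>j\<in>F. complex_of_real ((cmod (y t))\<^sup>2 * (cmod (x j t))\<^sup>2))"
      using x by (intro eventually_finite_subsets_at_top_weakI)
        (subst frame_partial_sum_C0(1)[OF y], auto)
    ultimately have "((\<lambda>j. complex_of_real ((cmod (y t))\<^sup>2 * (cmod (x j t))\<^sup>2)) has_sum ?s) J"
      unfolding has_sum_def by (rule Lim_transform_eventually)
    moreover have "?s - of_real c * (cnj (y t) * y t) \<in> \<real>\<^sub>\<ge>\<^sub>0"
    proof -
      have "hip ?H ?u (universal_rep ?A (\<lambda>t. of_real c * (cnj (y t) * y t)) ?u)
          = of_real c * (cnj (y t) * y t)"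
        by (rule hip_universal_point[OF t C0u_scale[OF mip_in_C0u[OF y y]]])
      moreover have "?s - hip ?H ?u (universal_rep ?A (\<lambda>t. of_real c * (cnj (y t) * y t)) ?u) \<in> \<real>\<^sub>\<ge>\<^sub>0"
        using le[unfolded op_le_def C0u_sel(5) C0_module_sel(2)] universal_point_in_carrier[OF t]
        by (rule bspec)
      ultimately show ?thesis by (simp only:)
    qed
    then have "?s - of_real (c * (cmod (y t))\<^sup>2) \<in> \<real>\<^sub>\<ge>\<^sub>0"
      by (simp only: of_real_mult complex_norm_square mult.commute)
    ultimately show ?thesis by blast
  qed
  with c show ?thesis by blast
qed

text \<open>A summable family has countable support, and the factor \<open>|y t|^2\<close> is
  nonzero, so it does not affect that support. If all \<open>x j\<close> vanished at
  \<open>t\<close>, the sum would be 0, below the positive lower bound.\<close>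

lemma frame_C0_pointwise:
  assumes frame: "frame (C0_unitalization X) (C0_module X) J x"
    and y: "y \<in> C0 X" "y t \<noteq> 0" and t: "t \<in> topspace X"
  shows "countable {j\<in>J. x j t \<noteq> 0}" "\<exists>j\<in>J. x j t \<noteq> 0"
proof -
  obtain c :: real and s where c: "c > 0"
    and sum: "((\<lambda>j. complex_of_real ((cmod (y t))\<^sup>2 * (cmod (x j t))\<^sup>2)) has_sum s) J"
    and s: "s - of_real (c * (cmod (y t))\<^sup>2) \<in> \<real>\<^sub>\<ge>\<^sub>0"
    using frame standard_frame_C0_has_sum nonstandard_frame_C0_has_sum y(1) t
    unfolding frame_def by blast
  have "countable {j\<in>J. complex_of_real ((cmod (y t))\<^sup>2 * (cmod (x j t))\<^sup>2) \<noteq> 0}"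
    using sum by (intro summable_countable_complex) (auto simp: summable_on_def)
  then show "countable {j\<in>J. x j t \<noteq> 0}" using y(2) by simp
  show "\<exists>j\<in>J. x j t \<noteq> 0"
  proof (rule ccontr)
    assume "\<not> ?thesis"
    then have "((\<lambda>j. complex_of_real ((cmod (y t))\<^sup>2 * (cmod (x j t))\<^sup>2)) has_sum 0) J"
      by (intro has_sum_0) simp
    then have "s = 0" using sum has_sum_unique by blast
    moreover have "c * (cmod (y t))\<^sup>2 > 0" using c y(2) by simp
    ultimately show False using s by (simp add: complex_nonneg_Reals_iff)
  qed
qed

section \<open>Frames in \<open>C\<^sub>0(K)\<close>\<close>

theorem theorem2p18:
  fixes P :: "'p topology" and J :: "'j set"
  assumes "class_K_IV P"
  shows "\<nexists>x. frame (C0_unitalization (space_K P)) (C0_module (space_K P)) J x"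
proof
  assume "\<exists>x. frame (C0_unitalization (space_K P)) (C0_module (space_K P)) J x"
  then obtain x where frame: "frame (C0_unitalization (space_K P)) (C0_module (space_K P)) J x" ..
  have x: "x j \<in> C0 (space_K P)" if "j \<in> J" for j
    using frame that by (auto simp: frame_def standard_frame_def nonstandard_frame_def)
  have P: "locally_compact_space P" "Hausdorff_space P"
    using assms by (auto simp: class_K_IV_def)
  define V where "V j = {p \<in> topspace P. x j (Some p, \<infinity>) \<noteq> 0}" for j
  have top: "(Some p, \<infinity>) \<in> topspace (space_K P)" if "p \<in> topspace P" for p
    using that by (simp add: topspace_space_K)
  have openV: "openin P (V j)" if "j \<in> J" for j
  proof -
    have "continuous_map P euclidean (\<lambda>p. x j (Some p, \<infinity>))"
      using continuous_map_compose[OF continuous_map_space_K_top C0_continuous[OF x[OF that]]]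
      by (simp add: o_def)
    then have "openin P {p \<in> topspace P. x j (Some p, \<infinity>) \<in> - {0}}"
      by (rule openin_continuous_map_preimage) auto
    then show ?thesis by (simp add: V_def)
  qed
  have sigmaV: "sigma_compactin P (V j)" if "j \<in> J" for j
  proof -
    \<comment> \<open>The levels \<open>1 / Suc n\<close> exhaust the nonzero values, and each
      \<open>C n\<close> is the trace on the slice of a compact superlevel set.\<close>
    define C where "C n = {p \<in> topspace P. 1 / real (Suc n) \<le> cmod (x j (Some p, \<infinity>))}" for n
    have "compactin P (C n)" for n
      using compactin_space_K_top[OF C0_compactin[OF x[OF that], of "1 / real (Suc n)"]] top
      by (auto simp: C_def elim!: back_subst[of "compactin P"])
    moreover have "V j = (\<Union>n. C n)"
    proof -
      have "z \<noteq> 0 \<longleftrightarrow> (\<exists>n. 1 / real (Suc n) \<le> cmod z)" for z :: complex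
      proof
        assume "z \<noteq> 0"
        then obtain n where "inverse (real (Suc n)) < cmod z"
          using reals_Archimedean[of "cmod z"] by auto
        then show "\<exists>n. 1 / real (Suc n) \<le> cmod z"
          by (intro exI[of _ n]) (simp add: inverse_eq_divide)
      next
        assume "\<exists>n. 1 / real (Suc n) \<le> cmod z"
        then show "z \<noteq> 0" by (auto simp: not_le)
      qed
      then show ?thesis unfolding V_def C_def by blast
    qed
    ultimately show ?thesis unfolding sigma_compactin_def by blast
  qed
  have "countable {j\<in>J. p \<in> V j} \<and> (\<exists>j\<in>J. p \<in> V j)" if p: "p \<in> topspace P" for p
  proof -
    obtain y where "y \<in> C0 (space_K P)" "y (Some p, \<infinity>) \<noteq> 0"
      using C0_space_K_nonzero[OF P p] by blast
    then show ?thesis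
      using frame_C0_pointwise[OF frame _ _ top[OF p]] p by (simp add: V_def)
  qed
  then show False
    by (intro class_K_IV_no_point_countable_cover[OF assms openV sigmaV, where J = J]) auto
qed

end
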